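(* Let $X$ be a Banach space, $(P_s)_{s\in\Gamma}$ a projectional skeleton on $X$ and let $D$ be the induced subspace of $X^*$. The following assertions are equivalent. (1) $D$ is a $\Sigma$-subspace of $X^*$. (2) There is a $\sigma$-closed cofinal subset $\Gamma'\subset\Gamma$ such that $P_sP_t=P_tP_s$ for $s,t\in\Gamma'$. (3) There is a $\sigma$-closed cofinal subset $\Gamma'\subset\Gamma$ such that the projection $P_A$ is $\sigma(X,D)$-to-$\sigma(X,D)$ continuous for any directed subset $A\subset\Gamma'$.
   Context: Banach spaces are real or complex. A projectional skeleton on $X$ is a family $(P_s)_{s\in\Gamma}$ of bounded linear projections on $X$ indexed by an up-directed partially ordered set $\Gamma$ such that: (i) $P_sX$ is separable; (ii) $P_sP_t=P_tP_s=P_s$ whenever $s\le t$; (iii) if $(s_n)$ is an increasing (non-decreasing) sequence in $\Gamma$, then $s=\sup_ns_n$ exists in $\Gamma$ and $P_sX=\overline{\bigcup_nP_{s_n}X}$; (iv) $X=\bigcup_sP_sX$. The subspace of $X^*$ induced by it is $D=\bigcup_{s\in\Gamma}P_s^*X^*$. $\Gamma'\subset\Gamma$ is cofinal if for each $s\in\Gamma$ there is $t\in\Gamma'$ with $s\le t$; it is $\sigma$-closed if the supremum in $\Gamma$ of every increasing sequence in $\Gamma'$ belongs to $\Gamma'$. For a nonempty directed $A\subset\Gamma$, $P_Ax=\lim_{s\in A}P_sx$ (norm limit of the net) for $x\in X$; when the projections $P_s$, $s\in A$, are uniformly bounded, this is a well-defined bounded projection of $X$ onto $\overline{\bigcup_{s\in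 A}P_sX}$. $P_\emptyset=0$. Assertion (3) includes the requirement that the projections $P_A$, $A\subset\Gamma'$ directed, are well defined. $\sigma(X,D)$ is the weakest topology on $X$ making all functionals from $D$ continuous. $D\subset X^*$ is a $\Sigma$-subspace of $X^*$ if there is $M\subset X$ with $\overline{\operatorname{span}}M=X$ and $D=\{x^*\in X^*:\{x\in M:x^*(x)\neq0\}\text{ is countable}\}$. *)

theory Defs
  imports "HOL-Analysis.Analysis" "HOL-Library.Lub_Glb"
begin

text \<open>The scalar field is \<open>\<real>\<close> or \<open>\<complex>\<close>. The absolute value need not be prescribed: since the norm of a
  \<^class>\<open>real_normed_field\<close> is multiplicative and extends the absolute value of \<open>\<real>\<close>, the norm of
  \<open>x + y * i\<close> is necessarily \<open>sqrt (x\<^sup>2 + y\<^sup>2)\<close>.\<close>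

class real_or_complex = real_normed_field +
  assumes real_or_complex:
    "(\<forall>z. \<exists>x. z = x *\<^sub>R 1) \<or> (\<exists>i. i * i = - 1 \<and> (\<forall>z. \<exists>x y. z = x *\<^sub>R 1 + y *\<^sub>R i))"

instance real :: real_or_complex
  by standard simp

instance complex :: real_or_complex
proof
  have "z = Re z *\<^sub>R 1 + Im z *\<^sub>R \<i>" for z :: complex
    by (simp add: complex_eq_iff)
  then show "(\<forall>z::complex. \<exists>x. z = x *\<^sub>R 1) \<or>
      (\<exists>i::complex. i * i = - 1 \<and> (\<forall>z. \<exists>x y. z = x *\<^sub>R 1 + y *\<^sub>R i))"
    using i_squared by blast
qed

text \<open>A Banach space over \<open>'k\<close>: the class \<^class>\<open>banach\<close> supplies the complete norm and the real structure,
  which the multiplication by scalars from \<open>'k\<close> extends.\<close>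

locale banach_over = vector_space smul
  for smul :: "'k::real_or_complex \<Rightarrow> 'a::banach \<Rightarrow> 'a" +
  assumes smul_of_real: "smul (of_real r) x = r *\<^sub>R x"
    and norm_smul: "norm (smul c x) = norm c * norm x"

lemma banach_over_scaleR: "banach_over (scaleR :: real \<Rightarrow> 'a::banach \<Rightarrow> 'a)"
  by unfold_locales (auto simp: algebra_simps)

lemma banach_over_complex: "banach_over ((*) :: complex \<Rightarrow> complex \<Rightarrow> complex)"
  by unfold_locales (auto simp: algebra_simps scaleR_conv_of_real norm_mult)

definition dual_space ::
    "('k::real_or_complex \<Rightarrow> 'a::banach \<Rightarrow> 'a) \<Rightarrow> ('a \<Rightarrow> 'k) set" where
  "dual_space smul = {f. Vector_Spaces.linear smul (*) f \<and> bounded_linear f}"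

definition bounded_projection ::
    "('k::real_or_complex \<Rightarrow> 'a::banach \<Rightarrow> 'a) \<Rightarrow> ('a \<Rightarrow> 'a) \<Rightarrow> bool" where
  "bounded_projection smul Q \<longleftrightarrow>
     Vector_Spaces.linear smul smul Q \<and> bounded_linear Q \<and> Q \<circ> Q = Q"

definition directed :: "'i::order set \<Rightarrow> bool" where
  "directed A \<longleftrightarrow> (\<forall>s\<in>A. \<forall>t\<in>A. \<exists>u\<in>A. s \<le> u \<and> t \<le> u)"

text \<open>The index set \<open>\<Gamma>\<close> is the whole type \<open>'i\<close>.\<close>

locale projectional_skeleton = banach_over smul
  for smul :: "'k::real_or_complex \<Rightarrow> 'a::banach \<Rightarrow> 'a" +
  fixes P :: "'i::order \<Rightarrow> 'a \<Rightarrow> 'a"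
  assumes up_directed: "directed (UNIV :: 'i set)"
    and projection: "bounded_projection smul (P s)"
    and separable: "separable_space (top_of_set (range (P s)))"
    and compatible: "s \<le> t \<Longrightarrow> P s \<circ> P t = P s \<and> P t \<circ> P s = P s"
    and sup_of_sequence: "mono (\<sigma> :: nat \<Rightarrow> 'i) \<Longrightarrow>
      \<exists>s. isLub UNIV (range \<sigma>) s \<and> range (P s) = closure (\<Union>n. range (P (\<sigma> n)))"
    and covers: "(\<Union>s. range (P s)) = UNIV"

text \<open>The range of the adjoint of \<open>P s\<close> consists of the functionals \<open>f \<circ> P s\<close>.\<close>

definition induced_subspace ::
    "('k::real_or_complex \<Rightarrow> 'a::banach \<Rightarrow> 'a) \<Rightarrow> ('i \<Rightarrow> 'a \<Rightarrow> 'a) \<Rightarrow> ('a \<Rightarrow> 'k) set" where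
  "induced_subspace smul P = (\<Union>s. (\<lambda>f. f \<circ> P s) ` dual_space smul)"

definition cofinal_subset :: "'i::order set \<Rightarrow> bool" where
  "cofinal_subset G \<longleftrightarrow> (\<forall>s. \<exists>t\<in>G. s \<le> t)"

definition sigma_closed :: "'i::order set \<Rightarrow> bool" where
  "sigma_closed G \<longleftrightarrow>
     (\<forall>\<sigma>::nat \<Rightarrow> 'i. \<forall>s. mono \<sigma> \<longrightarrow> range \<sigma> \<subseteq> G \<longrightarrow> isLub UNIV (range \<sigma>) s \<longrightarrow> s \<in> G)"

text \<open>Convergence of a net indexed by a nonempty directed set \<open>A\<close> is convergence along the filter
  generated by the tails of \<open>A\<close>.\<close>

definition tails :: "'i::order set \<Rightarrow> 'i filter" where
  "tails A = (INF s\<in>A. principal {t\<in>A. s \<le> t})"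

definition limit_projection :: "('i::order \<Rightarrow> 'a::banach \<Rightarrow> 'a) \<Rightarrow> 'i set \<Rightarrow> 'a \<Rightarrow> 'a" where
  "limit_projection P A x = (if A = {} then 0 else Lim (tails A) (\<lambda>s. P s x))"

text \<open>Since \<^const>\<open>Lim\<close> is a total function, existence of the limits has to be required separately.\<close>

definition well_defined_limit_projection ::
    "('k::real_or_complex \<Rightarrow> 'a::banach \<Rightarrow> 'a) \<Rightarrow> ('i::order \<Rightarrow> 'a \<Rightarrow> 'a) \<Rightarrow> 'i set \<Rightarrow> bool" where
  "well_defined_limit_projection smul P A \<longleftrightarrow>
     (A \<noteq> {} \<longrightarrow> (\<forall>x. \<exists>l. ((\<lambda>s. P s x) \<longlongrightarrow> l) (tails A))) \<and>
     bounded_projection smul (limit_projection P A)"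

definition weak_topology :: "('a \<Rightarrow> 'k::topological_space) set \<Rightarrow> 'a topology" where
  "weak_topology D = topology_generated_by {f -` U | f U. f \<in> D \<and> open U}"

definition Sigma_subspace ::
    "('k::real_or_complex \<Rightarrow> 'a::banach \<Rightarrow> 'a) \<Rightarrow> ('a \<Rightarrow> 'k) set \<Rightarrow> bool" where
  "Sigma_subspace smul D \<longleftrightarrow>
     (\<exists>M. closure (module.span smul M) = UNIV \<and>
          D = {f \<in> dual_space smul. countable {x \<in> M. f x \<noteq> 0}})"

end

theory Submission
  imports Defs
begin

text \<open>Two ideas drive the proof. The first is closing off: an index above a given one can always be found
  that meets countably many requirements concerning separable data, by taking the supremum of an
  increasing sequence in which each member settles the requirements posed by its predecessor
  (\<open>closing_off_sequence\<close>). On a suitable \<open>\<sigma>\<close>-closed cofinal set the projections are uniformly bounded,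
  and then \<open>P (\<sigma> n) x\<close> converges to the value of the projection at the supremum, so that the supremum
  inherits what was arranged along the sequence.

  From a set \<open>M\<close> witnessing that \<open>D\<close> is a \<open>\<Sigma>\<close>-subspace one gets commuting projections in this way: only
  countably many \<open>x \<in> M\<close> have \<open>P s x \<noteq> 0\<close>, so one can close off to \<open>P s x \<in> {0, x}\<close> for all \<open>x \<in> M\<close>
  (\<open>cofinal_splitting\<close>), and projections which act like this on a set with dense span commute. If the
  projections commute and \<open>f = f \<circ> P s\<close>, then \<open>f \<circ> P\<^sub>A = f \<circ> P\<^sub>A \<circ> P s\<close> lies in \<open>D\<close>, which is the weak
  continuity of \<open>P\<^sub>A\<close>. For linear operators weak continuity means just that \<open>f \<circ> P\<^sub>A \<in> D\<close> for \<open>f \<in> D\<close>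
  (\<open>D_operator_if_continuous\<close>).

  The second idea leads from weakly continuous limit projections back to a \<open>\<Sigma>\<close>-subspace. By induction
  on the density, every weakly continuous projection \<open>Q\<close> has in its range a set \<open>M\<close> with dense span on
  which each \<open>f \<in> D\<close> has countable support (\<open>countably_supporting_set_exists\<close>). Well-order a dense set
  in the order type of its cardinality, attach to every finite subset \<open>F\<close> an index \<open>h F\<close>, monotonically
  in \<open>F\<close>, and let \<open>R T = P\<^sub>A \<circ> Q\<close> where \<open>A\<close> consists of the indices of the finite subsets of \<open>T\<close>. Along
  the initial segments these projections form a resolution of \<open>Q\<close> whose steps have smaller density, so
  \<open>M\<close> is assembled from sets provided by the induction. What has to be shown is that \<open>f \<in> D\<close> is nonzero
  on the ranges of only countably many steps (\<open>countable_active_steps\<close>). Here \<open>P s\<close> with \<open>f = f \<circ> P s\<close>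
  cannot commute with all the steps at once, but a weakly continuous operator commutes with \<open>P s\<close> for
  many \<open>s\<close> (\<open>commuting_index_above\<close>), and it suffices to achieve this for the countably many steps
  that do not vanish on the range of \<open>P s\<close>. Finally, a set with dense span on which all of \<open>D\<close> has
  countable supports already witnesses that \<open>D\<close> is a \<open>\<Sigma>\<close>-subspace (\<open>Sigma_subspaceI\<close>).\<close>

section \<open>Norming functionals\<close>

definition sublinear :: "('a::real_vector \<Rightarrow> real) \<Rightarrow> bool" where
  "sublinear p \<longleftrightarrow> (\<forall>x y. p (x + y) \<le> p x + p y) \<and> (\<forall>c\<ge>0. \<forall>x. p (c *\<^sub>R x) \<le> c * p x)"

lemma sublinear_add: "sublinear p \<Longrightarrow> p (x + y) \<le> p x + p y"
  and sublinear_scale_le: "sublinear p \<Longrightarrow> c \<ge> 0 \<Longrightarrow> p (c *\<^sub>R x) \<le> c * p x"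
  by (auto simp: sublinear_def)

lemma sublinear_zero:
  assumes "sublinear p"
  shows "p 0 = 0"
  using sublinear_add[OF assms, of 0 0] sublinear_scale_le[OF assms, of 0 0] by simp

lemma sublinear_scale:
  assumes "sublinear p" "c \<ge> 0"
  shows "p (c *\<^sub>R x) = c * p x"
proof (cases "c = 0")
  case False
  have "p ((1 / c) *\<^sub>R (c *\<^sub>R x)) \<le> (1 / c) * p (c *\<^sub>R x)"
    using assms by (intro sublinear_scale_le) auto
  with False assms have "c * p x \<le> p (c *\<^sub>R x)"
    by (simp add: field_simps)
  then show ?thesis
    using sublinear_scale_le[OF assms, of x] by simp
qed (simp add: sublinear_zero[OF assms(1)])

lemma sublinear_minus: "sublinear p \<Longrightarrow> - p (- x) \<le> p x"
  using sublinear_add[of p x "- x"] by (simp add: sublinear_zero)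

text \<open>The new functional is \<open>\<lambda>x. inf {p (x + t z) - t p z | t \<ge> 0}\<close>; the term \<open>t = 0\<close> keeps it below \<open>p\<close>, and
  the term \<open>t = 1\<close> makes it small at \<open>- z\<close>. Applied to a minimal \<open>p\<close> this forces \<open>p (- z) = - p z\<close>, hence
  linearity; applied to the norm it prepares for a functional that attains the norm at \<open>z\<close>.\<close>

lemma sublinear_decrease:
  fixes z :: "'a::real_vector"
  assumes p: "sublinear p"
  obtains q where "sublinear q" "q \<le> p" "q (- z) \<le> - p z"
proof -
  define q where "q x = (INF t\<in>{0..}. p (x + t *\<^sub>R z) - t * p z)" for x
  have bdd: "bdd_below ((\<lambda>t. p (x + t *\<^sub>R z) - t * p z) ` {0..})" for x
  proof (rule bdd_belowI2[where m = "- p (- x)"])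
    fix t :: real assume "t \<in> {0..}"
    then show "- p (- x) \<le> p (x + t *\<^sub>R z) - t * p z"
      using sublinear_add[OF p, of "x + t *\<^sub>R z" "- x"] sublinear_scale[OF p, of t z] by simp
  qed
  have q_le: "q x \<le> p (x + t *\<^sub>R z) - t * p z" if "t \<ge> 0" for x t
    unfolding q_def using that by (intro cINF_lower[OF bdd]) auto
  have q_ge: "m \<le> q x" if "\<And>t. t \<ge> 0 \<Longrightarrow> m \<le> p (x + t *\<^sub>R z) - t * p z" for x m
    unfolding q_def using that by (intro cINF_greatest) auto
  have q_add: "q (x + y) \<le> q x + q y" for x y
  proof -
    have *: "q (x + y) \<le> (p (x + t *\<^sub>R z) - t * p z) + (p (y + u *\<^sub>R z) - u * p z)"
      if "t \<ge> 0" "u \<ge> 0" for t u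
      using q_le[of "t + u" "x + y"] sublinear_add[OF p, of "x + t *\<^sub>R z" "y + u *\<^sub>R z"] that
      by (simp add: algebra_simps)
    have "q (x + y) - (p (x + t *\<^sub>R z) - t * p z) \<le> q y" if "t \<ge> 0" for t
    proof (rule q_ge)
      fix u :: real assume "u \<ge> 0"
      then show "q (x + y) - (p (x + t *\<^sub>R z) - t * p z) \<le> p (y + u *\<^sub>R z) - u * p z"
        using *[OF that \<open>u \<ge> 0\<close>] by (simp add: algebra_simps)
    qed
    then have "q (x + y) - q y \<le> q x"
      by (intro q_ge) (auto simp: algebra_simps)
    then show ?thesis by simp
  qed
  have q_scale: "q (c *\<^sub>R x) \<le> c * q x" if "c > 0" for c x
  proof -
    have "q (c *\<^sub>R x) / c \<le> q x"
    proof (rule q_ge)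
      fix t :: real assume "t \<ge> 0"
      then have "q (c *\<^sub>R x) \<le> p (c *\<^sub>R (x + t *\<^sub>R z)) - c * t * p z"
        using q_le[of "c * t" "c *\<^sub>R x"] that by (simp add: scaleR_add_right)
      also have "\<dots> = c * (p (x + t *\<^sub>R z) - t * p z)"
        using sublinear_scale[OF p, of c "x + t *\<^sub>R z"] that by (simp add: right_diff_distrib)
      finally show "q (c *\<^sub>R x) / c \<le> p (x + t *\<^sub>R z) - t * p z"
        using that by (simp add: field_simps)
    qed
    with that show ?thesis by (simp add: field_simps)
  qed
  have q_le_p: "q x \<le> p x" for x
    using q_le[of 0 x] by simp
  have "sublinear q"
    unfolding sublinear_def
  proof (intro conjI allI impI)
    fix c :: real and x assume "c \<ge> 0"
    then show "q (c *\<^sub>R x) \<le> c * q x"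
      using q_scale[of c x] q_le_p[of 0] sublinear_zero[OF p] by (cases "c = 0") auto
  qed (rule q_add)
  moreover have "q (- z) \<le> - p z"
    using q_le[of 1 "- z"] sublinear_zero[OF p] by simp
  ultimately show ?thesis
    using q_le_p by (intro that) (auto simp: le_fun_def)
qed

text \<open>Zorn's lemma for the reversed pointwise order: the pointwise infimum of a chain is finite because
  \<open>q x \<ge> - q (- x) \<ge> - p (- x)\<close> for every member \<open>q\<close> of the chain.\<close>

lemma minimal_sublinear_exists:
  fixes p :: "'a::real_vector \<Rightarrow> real"
  assumes "sublinear p"
  obtains m where "sublinear m" "m \<le> p" "\<And>q. sublinear q \<Longrightarrow> q \<le> m \<Longrightarrow> q = m"
proof -
  let ?A = "{q. sublinear q \<and> q \<le> p}"
  have "\<exists>m\<in>?A. \<forall>q\<in>?A. q \<le> m \<longrightarrow> q = m"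
  proof (rule predicate_Zorn)
    show "partial_order_on ?A (relation_of (\<lambda>x y. y \<le> x) ?A)"
      by (rule partial_order_on_relation_ofI) auto
  next
    fix C assume C: "C \<in> Chains (relation_of (\<lambda>x y. y \<le> x) ?A)"
    show "\<exists>u\<in>?A. \<forall>a\<in>C. u \<le> a"
    proof (cases "C = {}")
      case True
      then show ?thesis using assms by auto
    next
      case False
      have sub: "sublinear q" "q \<le> p" if "q \<in> C" for q
        using C that by (auto simp: Chains_def relation_of_def)
      have chain: "q \<le> q' \<or> q' \<le> q" if "q \<in> C" "q' \<in> C" for q q'
        using C that by (auto simp: Chains_def relation_of_def)
      define u where "u x = (INF q\<in>C. q x)" for x
      have bdd: "bdd_below ((\<lambda>q. q x) ` C)" for x
      proof (rule bdd_belowI2)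
        fix q assume "q \<in> C"
        then show "- p (- x) \<le> q x"
          using sublinear_minus[OF sub(1), of q x] le_funD[OF sub(2), of q "- x"] by simp
      qed
      have u_le: "u x \<le> q x" if "q \<in> C" for x q
        unfolding u_def using that by (intro cINF_lower[OF bdd])
      have u_ge: "c \<le> u x" if "\<And>q. q \<in> C \<Longrightarrow> c \<le> q x" for x c
        unfolding u_def using that False by (intro cINF_greatest) auto
      have "sublinear u"
        unfolding sublinear_def
      proof (intro conjI allI impI)
        fix x y
        have *: "u (x + y) \<le> q x + q' y" if q: "q \<in> C" "q' \<in> C" for q q'
        proof -
          \<comment> \<open>the smaller one of \<open>q\<close> and \<open>q'\<close> is subadditive and bounds \<open>u\<close>\<close>
          obtain r where "r \<in> C" "r \<le> q" "r \<le> q'"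
            using chain q by blast
          then show ?thesis
            using u_le[of r "x + y"] sublinear_add[OF sub(1), of r x y]
            by (auto simp: le_fun_def) (smt (verit))
        qed
        have "u (x + y) - q x \<le> q' y" if "q \<in> C" "q' \<in> C" for q q'
          using *[OF that] by (simp add: algebra_simps)
        then have "u (x + y) - q x \<le> u y" if "q \<in> C" for q
          using that by (intro u_ge) auto
        then have "u (x + y) - u y \<le> u x"
          by (intro u_ge) (auto simp: algebra_simps)
        then show "u (x + y) \<le> u x + u y" by simp
      next
        fix c :: real and x assume c: "c \<ge> 0"
        show "u (c *\<^sub>R x) \<le> c * u x"
        proof (cases "c = 0")
          case True
          obtain q where q: "q \<in> C" using False by blast
          show ?thesis
            using True u_le[OF q, of 0] sublinear_zero[OF sub(1)[OF q]] by simp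
        next
          case c': False
          have "u (c *\<^sub>R x) / c \<le> u x"
          proof (rule u_ge)
            fix q assume "q \<in> C"
            then show "u (c *\<^sub>R x) / c \<le> q x"
              using u_le[of q "c *\<^sub>R x"] sublinear_scale[OF sub(1) c, of q x] c c'
              by (simp add: field_simps)
          qed
          then show ?thesis using c c' by (simp add: field_simps)
        qed
      qed
      moreover have "u \<le> p"
      proof -
        obtain q where "q \<in> C" using False by blast
        then have "u \<le> q" by (simp add: le_fun_def u_le)
        then show ?thesis using sub(2)[OF \<open>q \<in> C\<close>] by order
      qed
      ultimately show ?thesis
        using u_le by (intro bexI[of _ u]) (auto simp: le_fun_def)
    qed
  qed
  then obtain m where "m \<in> ?A" and m: "\<forall>q\<in>?A. q \<le> m \<longrightarrow> q = m" by blast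
  show ?thesis
  proof (rule that)
    show "sublinear m" "m \<le> p" using \<open>m \<in> ?A\<close> by auto
    fix q assume "sublinear q" "q \<le> m"
    moreover have "q \<le> p" using \<open>q \<le> m\<close> \<open>m \<in> ?A\<close> order_trans by blast
    ultimately show "q = m" using m by blast
  qed
qed

text \<open>The Hahn-Banach theorem in the form needed here. Working with functionals on the whole space that
  decrease to a linear one avoids partial functions and extensions.\<close>

lemma norming_functional_exists:
  fixes y :: "'a::real_normed_vector"
  obtains g :: "'a \<Rightarrow> real" where "bounded_linear g" "\<And>x. \<bar>g x\<bar> \<le> norm x" "g y = norm y"
proof -
  have "sublinear (norm :: 'a \<Rightarrow> real)"
    by (simp add: sublinear_def norm_triangle_ineq)
  then obtain p :: "'a \<Rightarrow> real" where p: "sublinear p" "p \<le> norm" "p (- y) \<le> - norm y"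
    by (rule sublinear_decrease)
  obtain g where g: "sublinear g" "g \<le> p" and min: "\<And>q. sublinear q \<Longrightarrow> q \<le> g \<Longrightarrow> q = g"
    using minimal_sublinear_exists[OF p(1)] by blast
  have odd: "g (- z) = - g z" for z
  proof -
    obtain q where "sublinear q" "q \<le> g" "q (- z) \<le> - g z"
      using sublinear_decrease[OF g(1)] by blast
    then have "g (- z) \<le> - g z" using min by metis
    then show ?thesis using sublinear_minus[OF g(1), of z] by simp
  qed
  have le: "g x \<le> norm x" for x
    using g(2) p(2) by (auto simp: le_fun_def intro: order_trans)
  have abs: "\<bar>g x\<bar> \<le> norm x" for x
    using le[of x] le[of "- x"] odd[of x] by auto
  have add: "g (a + b) = g a + g b" for a b
    using sublinear_add[OF g(1), of a b] sublinear_add[OF g(1), of "- a" "- b"]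
      odd[of a] odd[of b] odd[of "a + b"] by simp
  have scale: "g (c *\<^sub>R x) = c * g x" for c x
    using sublinear_scale[OF g(1), of c x] sublinear_scale[OF g(1), of "- c" x]
      odd[of "c *\<^sub>R x"] by (cases "c \<ge> 0") auto
  have "bounded_linear g"
    using add scale abs by (intro bounded_linear_intro[where K = 1]) auto
  moreover have "g y = norm y"
  proof (rule antisym[OF le])
    have "g (- y) \<le> - norm y" using g(2) p(3) by (auto simp: le_fun_def intro: order_trans)
    then show "norm y \<le> g y" using odd[of y] by simp
  qed
  ultimately show ?thesis using that abs by blast
qed

lemma vector_space_field: "vector_space ((*) :: 'k::field \<Rightarrow> 'k \<Rightarrow> 'k)"
  by unfold_locales (auto simp: algebra_simps)

context banach_over
begin

lemma vector_space_smul: "vector_space smul"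
  by unfold_locales

lemma dual_space_iff:
  "f \<in> dual_space smul \<longleftrightarrow> bounded_linear f \<and> (\<forall>c x. f (smul c x) = c * f x)"
  by (auto simp: dual_space_def Vector_Spaces.linear_iff vector_space_smul vector_space_field
      bounded_linear.linear linear_add)

lemma dual_space_bounded_linear: "f \<in> dual_space smul \<Longrightarrow> bounded_linear f"
  by (simp add: dual_space_iff)

lemma bounded_linear_smul: "bounded_linear (smul c)"
proof (rule bounded_linear_intro)
  fix r x show "smul c (r *\<^sub>R x) = r *\<^sub>R smul c x"
    by (metis mult.commute scale_scale smul_of_real)
next
  fix x show "norm (smul c x) \<le> norm x * norm c"
    by (simp add: norm_smul mult.commute)
qed (rule scale_right_distrib)

text \<open>Over the complex scalars, the real functional \<open>g\<close> is the real part of the functional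
  \<open>x \<mapsto> g x - i g (i x)\<close>, whose kernel is therefore contained in that of \<open>g\<close>.\<close>

lemma real_functional_dominated_by_dual:
  fixes g :: "'a \<Rightarrow> real"
  assumes g: "bounded_linear g"
  obtains f where "f \<in> dual_space smul" "\<And>x. f x = 0 \<Longrightarrow> g x = 0"
  using real_or_complex[where 'a = 'k]
proof
  assume real: "\<forall>z::'k. \<exists>x. z = x *\<^sub>R 1"
  define f :: "'a \<Rightarrow> 'k" where "f x = of_real (g x)" for x
  have "f (smul c x) = c * f x" for c x
  proof -
    obtain r where "c = of_real r" using real by (metis of_real_def)
    then show ?thesis
      using g by (simp add: f_def smul_of_real bounded_linear.linear linear_scale)
  qed
  moreover have "bounded_linear f"
    unfolding f_def using g by (rule bounded_linear_compose[OF bounded_linear_of_real])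
  ultimately show thesis
    by (intro that[of f]) (auto simp: dual_space_iff f_def)
next
  assume "\<exists>i::'k. i * i = - 1 \<and> (\<forall>z. \<exists>x y. z = x *\<^sub>R 1 + y *\<^sub>R i)"
  then obtain i :: 'k where i: "i * i = - 1" and span: "\<And>z. \<exists>x y. z = x *\<^sub>R 1 + y *\<^sub>R i"
    by blast
  define f :: "'a \<Rightarrow> 'k" where "f x = of_real (g x) - i * of_real (g (smul i x))" for x
  have lin: "bounded_linear f"
    unfolding f_def
    by (intro bounded_linear_sub bounded_linear_compose[OF bounded_linear_of_real]
        bounded_linear_compose[OF bounded_linear_mult_right] bounded_linear_compose[OF g]
        bounded_linear_smul bounded_linear_ident g)
  have fi: "f (smul i x) = i * f x" for x
  proof -
    have "g (smul i (smul i x)) = - g x"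
      using g i by (simp add: scale_scale bounded_linear.linear linear_neg)
    then have "f (smul i x) = of_real (g (smul i x)) + i * of_real (g x)"
      by (simp add: f_def)
    moreover have "i * f x = i * of_real (g x) - (i * i) * of_real (g (smul i x))"
      by (simp add: f_def algebra_simps)
    ultimately show ?thesis by (simp add: i)
  qed
  have fr: "f (smul (of_real r) x) = of_real r * f x" for r x
    using lin by (simp add: smul_of_real bounded_linear.linear linear_scale scaleR_conv_of_real)
  have "f (smul c x) = c * f x" for c x
  proof -
    obtain a b where "c = a *\<^sub>R 1 + b *\<^sub>R i" using span by blast
    then have c: "c = of_real a + of_real b * i" by (simp add: scaleR_conv_of_real)
    have "f (smul c x) = f (smul (of_real a) x) + f (smul (of_real b) (smul i x))"
      using lin by (simp add: c scale_left_distrib bounded_linear.linear linear_add)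
    also have "\<dots> = c * f x" by (simp only: fr fi) (simp add: c algebra_simps)
    finally show ?thesis .
  qed
  moreover have "g x = 0" if "f x = 0" for x
  proof -
    define a b where "a = g x" and "b = g (smul i x)"
    have *: "of_real a = i * (of_real b :: 'k)" using that by (simp add: f_def a_def b_def)
    have "of_real (a * a) = (i * i) * (of_real (b * b) :: 'k)"
      using * by (simp add: algebra_simps)
    then have "(of_real (a * a) :: 'k) = of_real (- (b * b))" by (simp add: i)
    then have "a * a + b * b = 0" by (simp only: of_real_eq_iff)
    then show ?thesis by (simp add: a_def sum_squares_eq_zero_iff)
  qed
  ultimately show thesis
    using lin by (intro that[of f]) (auto simp: dual_space_iff)
qed

text \<open>If \<open>g z\<close> norms \<open>z\<close> and \<open>z\<close> is closer to \<open>y\<close> than half the norm of \<open>y\<close>, then \<open>g z y \<noteq> 0\<close>. So norming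
  functionals for a countable dense set separate points.\<close>

lemma countable_separating_functionals:
  assumes "countable d"
  obtains F where "countable F" "F \<subseteq> dual_space smul"
    "\<And>y. y \<in> closure d \<Longrightarrow> (\<And>f. f \<in> F \<Longrightarrow> f y = 0) \<Longrightarrow> y = 0"
proof -
  have "\<exists>f\<in>dual_space smul. \<exists>g::'a \<Rightarrow> real. bounded_linear g \<and> (\<forall>x. \<bar>g x\<bar> \<le> norm x) \<and> g z = norm z \<and>
      (\<forall>x. f x = 0 \<longrightarrow> g x = 0)" for z
    by (metis norming_functional_exists real_functional_dominated_by_dual)
  then obtain f g where f: "\<And>z. f z \<in> dual_space smul"
    and g: "\<And>z. bounded_linear (g z)" "\<And>z x. \<bar>g z x\<bar> \<le> norm x" "\<And>z. g z z = norm z"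
    and fg: "\<And>z x. f z x = 0 \<Longrightarrow> g z x = (0::real)"
    by metis
  show ?thesis
  proof (rule that[of "f ` d"])
    fix y assume y: "y \<in> closure d" and 0: "\<And>h. h \<in> f ` d \<Longrightarrow> h y = 0"
    show "y = 0"
    proof (rule ccontr)
      assume "y \<noteq> 0"
      then obtain z where z: "z \<in> d" "dist z y < norm y / 2"
        using y by (metis closure_approachable half_gt_zero zero_less_norm_iff)
      then have "norm z = g z (z - y)"
        using 0 fg g by (simp add: bounded_linear.linear linear_diff)
      also have "\<dots> \<le> norm (z - y)" using g(2)[of z "z - y"] by simp
      finally show False
        using z(2) norm_triangle_sub[of y z] by (simp add: dist_norm norm_minus_commute)
    qed
  qed (use assms f in auto)
qed

end

section \<open>Projectional skeletons and their limit projections\<close>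

lemma eventually_tails:
  assumes "directed A" "A \<noteq> {}"
  shows "eventually Q (tails A) \<longleftrightarrow> (\<exists>s\<in>A. \<forall>t\<in>A. s \<le> t \<longrightarrow> Q t)"
  unfolding tails_def
proof (subst eventually_INF_base)
  fix a b assume "a \<in> A" "b \<in> A"
  then obtain u where "u \<in> A" "a \<le> u" "b \<le> u"
    using assms(1) by (auto simp: directed_def)
  then show "\<exists>x\<in>A. principal {t \<in> A. x \<le> t}
      \<le> inf (principal {t \<in> A. a \<le> t}) (principal {t \<in> A. b \<le> t})"
    by (intro bexI[of _ u]) auto
qed (use assms in \<open>auto simp: eventually_principal\<close>)

lemma tails_nontrivial: "directed A \<Longrightarrow> A \<noteq> {} \<Longrightarrow> tails A \<noteq> bot"
  by (auto simp: trivial_limit_def eventually_tails)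

lemma eventually_tailsI:
  assumes "directed A" "A \<noteq> {}" "\<And>s. s \<in> A \<Longrightarrow> Q s"
  shows "eventually Q (tails A)"
  using assms by (auto simp: eventually_tails)

lemma eventually_tails_ge:
  assumes "directed A" "s \<in> A"
  shows "eventually (\<lambda>t. t \<in> A \<and> s \<le> t) (tails A)"
  using assms by (subst eventually_tails) auto

context projectional_skeleton
begin

abbreviation D where "D \<equiv> induced_subspace smul P"

lemma P_bounded_linear: "bounded_linear (P s)"
  and P_smul: "P s (smul c x) = smul c (P s x)"
  and P_idem: "P s (P s x) = P s x"
  using projection[of s] by (auto simp: bounded_projection_def Vector_Spaces.linear_iff fun_eq_iff)

lemma P_diff: "P s (x - y) = P s x - P s y"
  using P_bounded_linear by (simp add: bounded_linear.linear linear_diff)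

lemma P_below:
  assumes "s \<le> t"
  shows "P s (P t x) = P s x" "P t (P s x) = P s x"
  using compatible[OF assms] by (auto simp: fun_eq_iff)

lemma range_P_iff: "x \<in> range (P s) \<longleftrightarrow> P s x = x"
  using P_idem by (metis rangeE rangeI)

lemma P_fixed_above: "s \<le> t \<Longrightarrow> P s x = x \<Longrightarrow> P t x = x"
  by (metis P_below(2))

lemma fixed_by_some_P: "\<exists>s. P s x = x"
  using covers range_P_iff by blast

lemma lub_unique:
  assumes "isLub UNIV A s" "isLub UNIV A (t::'i)"
  shows "s = t"
  using assms by (meson antisym isLub_isUb isLub_le_isUb)

lemma range_lub:
  fixes \<sigma> :: "nat \<Rightarrow> 'i"
  assumes "mono \<sigma>" "isLub UNIV (range \<sigma>) s"
  shows "range (P s) = closure (\<Union>n. range (P (\<sigma> n)))"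
  using sup_of_sequence[OF assms(1)] assms(2) lub_unique by blast

lemma countable_has_upper_bound:
  fixes A :: "'i set"
  assumes "countable A"
  obtains u where "\<And>a. a \<in> A \<Longrightarrow> a \<le> u"
proof (cases "A = {}")
  case False
  obtain e :: "nat \<Rightarrow> 'i" where e: "A = range e"
    using uncountable_def assms False by metis
  have "\<exists>\<sigma>. \<forall>n. e n \<le> \<sigma> n \<and> \<sigma> n \<le> \<sigma> (Suc n)"
    using up_directed by (intro dependent_nat_choice) (auto simp: directed_def)
  then obtain \<sigma> where \<sigma>: "\<And>n. e n \<le> \<sigma> n" "\<And>n. \<sigma> n \<le> \<sigma> (Suc n)" by blast
  obtain s where "isLub UNIV (range \<sigma>) s"
    using sup_of_sequence[of \<sigma>] \<sigma>(2) by (auto simp: mono_iff_le_Suc)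
  then have "e n \<le> s" for n
    using \<sigma>(1) isLubD2 by (metis order_trans rangeI)
  then show ?thesis using e that by blast
qed (use that in auto)

lemma countable_dense_in_range:
  obtains d where "countable d" "d \<subseteq> range (P s)" "range (P s) \<subseteq> closure d"
proof -
  obtain d where d: "countable d" "d \<subseteq> range (P s)"
    "top_of_set (range (P s)) closure_of d = range (P s)"
    using separable[of s] by (auto simp: separable_space_def)
  then have "range (P s) \<subseteq> closure d"
    using closure_of_subtopology_subset[of euclidean "range (P s)" d] by auto
  then show ?thesis using d that by blast
qed

lemma mem_D_iff: "f \<in> D \<longleftrightarrow> f \<in> dual_space smul \<and> (\<exists>s. \<forall>x. f (P s x) = f x)"
proof
  assume "f \<in> D"
  then obtain g s where g: "g \<in> dual_space smul" and f: "f = (\<lambda>x. g (P s x))"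
    by (auto simp: induced_subspace_def comp_def)
  have "bounded_linear f"
    unfolding f by (rule bounded_linear_compose[OF dual_space_bounded_linear[OF g] P_bounded_linear])
  then show "f \<in> dual_space smul \<and> (\<exists>s. \<forall>x. f (P s x) = f x)"
    using g by (auto simp: dual_space_iff f P_smul intro!: exI[of _ s] arg_cong[where f = g] P_idem)
next
  assume "f \<in> dual_space smul \<and> (\<exists>s. \<forall>x. f (P s x) = f x)"
  then obtain s where "f \<in> dual_space smul" "\<And>x. f (P s x) = f x" by blast
  then have "f \<in> dual_space smul" "f = f \<circ> P s" by (auto simp: fun_eq_iff)
  then show "f \<in> D" unfolding induced_subspace_def by blast
qed

lemma mem_dual_comp_P: "f \<in> dual_space smul \<Longrightarrow> (\<lambda>x. f (P s x)) \<in> D"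
  by (auto simp: induced_subspace_def comp_def)

lemma mem_D_above:
  assumes "\<And>x. f (P s x) = f x" "s \<le> t"
  shows "f (P t x) = f x"
  using assms by (metis P_below(1))

text \<open>Starting from \<open>s0\<close>, a requirement \<open>\<phi>\<close> that can be met by going up is met between all consecutive members
  of an increasing sequence, whose supremum stays in the \<open>\<sigma>\<close>-closed set.\<close>

lemma closing_off_sequence:
  assumes G: "sigma_closed G" "s0 \<in> G"
    and step: "\<forall>s\<in>G. \<exists>t\<in>G. s \<le> t \<and> \<phi> s t"
  obtains \<sigma> :: "nat \<Rightarrow> 'i" and s where "mono \<sigma>" "\<sigma> 0 = s0" "range \<sigma> \<subseteq> G" "\<And>n. \<phi> (\<sigma> n) (\<sigma> (Suc n))"
    "isLub UNIV (range \<sigma>) s" "s \<in> G"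
proof -
  have "\<exists>\<sigma>. \<forall>n. (\<sigma> n \<in> G \<and> (n = 0 \<longrightarrow> \<sigma> n = s0)) \<and> (\<sigma> n \<le> \<sigma> (Suc n) \<and> \<phi> (\<sigma> n) (\<sigma> (Suc n)))"
    by (rule dependent_nat_choice) (use G step in auto)
  then obtain \<sigma> where \<sigma>: "\<And>n. \<sigma> n \<in> G" "\<sigma> 0 = s0" "\<And>n. \<sigma> n \<le> \<sigma> (Suc n)"
    "\<And>n. \<phi> (\<sigma> n) (\<sigma> (Suc n))" by blast
  have "mono \<sigma>" "range \<sigma> \<subseteq> G" using \<sigma> by (auto simp: mono_iff_le_Suc)
  obtain s where s: "isLub UNIV (range \<sigma>) s" using sup_of_sequence[OF \<open>mono \<sigma>\<close>] by blast
  then have "s \<in> G"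
    using G(1) \<open>mono \<sigma>\<close> \<open>range \<sigma> \<subseteq> G\<close> unfolding sigma_closed_def by blast
  show ?thesis by (rule that) fact+
qed

text \<open>With uniform bounds, convergence needs checking only on the dense union of the ranges, where the
  sequence is eventually constant.\<close>

lemma tendsto_P_lub:
  fixes \<sigma> :: "nat \<Rightarrow> 'i"
  assumes \<sigma>: "mono \<sigma>" "isLub UNIV (range \<sigma>) s"
    and K: "\<And>n x. norm (P (\<sigma> n) x) \<le> K * norm x"
  shows "(\<lambda>n. P (\<sigma> n) x) \<longlonglongrightarrow> P s x"
proof (rule LIMSEQ_I)
  fix e :: real assume "e > 0"
  define e' where "e' = e / (\<bar>K\<bar> + 1)"
  have "e' > 0" using \<open>e > 0\<close> by (simp add: e'_def)
  have le_s: "\<sigma> n \<le> s" for n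
    using isLubD2[OF \<sigma>(2)] by blast
  define y where "y = P s x"
  have "y \<in> closure (\<Union>n. range (P (\<sigma> n)))"
    using range_lub[OF \<sigma>] by (auto simp: y_def)
  then obtain z N where "z \<in> range (P (\<sigma> N))" and zy: "dist z y < e'"
    using \<open>e' > 0\<close> unfolding closure_approachable by blast
  then have z: "P (\<sigma> N) z = z" by (simp add: range_P_iff)
  have "norm (P (\<sigma> n) x - P s x) < e" if "n \<ge> N" for n
  proof -
    have "P (\<sigma> n) z = z"
      using z \<sigma>(1) that by (meson P_fixed_above monoD)
    then have "P (\<sigma> n) x - y = P (\<sigma> n) (y - z) + (z - y)"
      using le_s[of n] by (simp add: y_def P_diff P_below)
    also have "norm \<dots> \<le> \<bar>K\<bar> * norm (y - z) + norm (z - y)"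
      using K[of n "y - z"] mult_right_mono[OF abs_ge_self[of K] norm_ge_zero[of "y - z"]]
      by (intro norm_triangle_le) linarith
    also have "\<dots> = (\<bar>K\<bar> + 1) * dist z y"
      by (simp add: dist_norm norm_minus_commute algebra_simps)
    also have "\<dots> < (\<bar>K\<bar> + 1) * e'"
      using zy by (intro mult_strict_left_mono) auto
    finally show ?thesis by (simp add: y_def e'_def)
  qed
  then show "\<exists>N. \<forall>n\<ge>N. norm (P (\<sigma> n) x - P s x) < e" by blast
qed

end

text \<open>Most arguments take place on a \<open>\<sigma>\<close>-closed cofinal set of indices with uniformly bounded projections.\<close>

locale bounded_skeleton = projectional_skeleton smul P
  for smul :: "'k::real_or_complex \<Rightarrow> 'a::banach \<Rightarrow> 'a" and P :: "'i::order \<Rightarrow> 'a \<Rightarrow> 'a" +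
  fixes G :: "'i set" and K :: real
  assumes sigma_closed_G: "sigma_closed G"
    and cofinal_G: "cofinal_subset G"
    and norm_P_le: "s \<in> G \<Longrightarrow> norm (P s x) \<le> K * norm x"

text \<open>If for no bound \<open>n\<close> the indices with norm at most \<open>n\<close> were cofinal in \<open>G\<close>, each \<open>n\<close> would have an index
  above which all norms exceed \<open>n\<close>; an element of \<open>G\<close> above all these indices would have infinite norm.
  Bounds pass to suprema of increasing sequences, because the projections converge there.\<close>

lemma (in projectional_skeleton) bounded_skeleton_exists:
  assumes "sigma_closed G" "cofinal_subset G"
  obtains G' K where "G' \<subseteq> G" "bounded_skeleton smul P G' K"
proof -
  let ?B = "\<lambda>n::nat. {s \<in> G. \<forall>x. norm (P s x) \<le> n * norm x}"
  have "\<exists>n. cofinal_subset (?B n)"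
  proof (rule ccontr)
    assume "\<nexists>n. cofinal_subset (?B n)"
    then obtain s where s: "\<And>n t. t \<in> ?B n \<Longrightarrow> \<not> s n \<le> t"
      by (auto simp: cofinal_subset_def) metis
    obtain u where "\<And>n. s n \<le> u"
      using countable_has_upper_bound[of "range s"] by (metis countableI_type countable_image rangeI)
    moreover obtain t where t: "t \<in> G" "u \<le> t"
      using assms(2) by (auto simp: cofinal_subset_def)
    ultimately have "t \<notin> ?B n" for n
      using s[of t n] order_trans by blast
    moreover obtain C where C: "\<And>x. norm (P t x) \<le> C * norm x"
      using P_bounded_linear[of t] bounded_linear.bounded by (metis mult.commute)
    have "t \<in> ?B (nat \<lceil>C\<rceil>)"
    proof -
      have "C * norm x \<le> real (nat \<lceil>C\<rceil>) * norm x" for x :: 'a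
        by (intro mult_right_mono) (auto simp: real_nat_ceiling_ge)
      then show ?thesis using t C order_trans by blast
    qed
    ultimately show False by blast
  qed
  then obtain n where n: "cofinal_subset (?B n)" by blast
  have "sigma_closed (?B n)"
    unfolding sigma_closed_def
  proof (intro allI impI)
    fix \<sigma> :: "nat \<Rightarrow> 'i" and s assume \<sigma>: "mono \<sigma>" "range \<sigma> \<subseteq> ?B n" "isLub UNIV (range \<sigma>) s"
    have "(\<lambda>k. P (\<sigma> k) x) \<longlonglongrightarrow> P s x" for x
      using \<sigma> by (intro tendsto_P_lub[where K = n]) auto
    then have "norm (P s x) \<le> n * norm x" for x
      by (rule LIMSEQ_le_const2[OF tendsto_norm]) (use \<sigma>(2) in blast)
    moreover have "s \<in> G"
      using \<sigma> assms(1) by (force simp: sigma_closed_def)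
    ultimately show "s \<in> ?B n" by blast
  qed
  with n have "bounded_skeleton smul P (?B n) n"
    by unfold_locales auto
  then show ?thesis by (intro that[of "?B n" n]) auto
qed

context bounded_skeleton
begin

lemma G_above:
  obtains t where "t \<in> G" "s \<le> t"
  using cofinal_G by (auto simp: cofinal_subset_def)

lemma countable_has_upper_bound_G:
  fixes A :: "'i set"
  assumes "countable A"
  obtains u where "u \<in> G" "\<And>a. a \<in> A \<Longrightarrow> a \<le> u"
proof -
  obtain s where s: "\<And>a. a \<in> A \<Longrightarrow> a \<le> s"
    by (rule countable_has_upper_bound[OF assms]) blast
  obtain u where "u \<in> G" "s \<le> u" by (rule G_above)
  then show ?thesis using s that order_trans by blast
qed

lemma tendsto_P_lub_G:
  fixes \<sigma> :: "nat \<Rightarrow> 'i"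
  assumes "mono \<sigma>" "range \<sigma> \<subseteq> G" "isLub UNIV (range \<sigma>) s"
  shows "(\<lambda>n. P (\<sigma> n) x) \<longlonglongrightarrow> P s x"
  using assms norm_P_le by (intro tendsto_P_lub[where K = K]) auto

lemma separable_set_in_range_P:
  assumes "countable C" and B: "countable B"
  obtains t where "t \<in> G" "\<And>a. a \<in> B \<Longrightarrow> a \<le> t" "\<And>x. x \<in> closure C \<Longrightarrow> P t x = x"
proof -
  obtain s where s: "\<And>x. P (s x) x = x" using fixed_by_some_P by metis
  have "countable (B \<union> s ` C)" using assms by simp
  then obtain t where t: "t \<in> G" "\<And>a. a \<in> B \<union> s ` C \<Longrightarrow> a \<le> t"
    by (rule countable_has_upper_bound_G) blast
  have "closed {x. P t x = x}"
    by (rule closed_Collect_eq[OF linear_continuous_on[OF P_bounded_linear] continuous_on_id])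
  moreover have "C \<subseteq> {x. P t x = x}"
  proof clarify
    fix x assume "x \<in> C"
    then have "s x \<le> t" using t(2) by blast
    then show "P t x = x" using s P_fixed_above by blast
  qed
  ultimately have "closure C \<subseteq> {x. P t x = x}" by (rule closure_minimal[rotated])
  then show thesis using that t B by blast
qed

context
  fixes A :: "'i set"
  assumes A: "A \<subseteq> G" "directed A" "A \<noteq> {}"
begin

lemma tails_ex_close:
  assumes "e > 0" "s0 \<in> A"
  shows "\<exists>s\<in>A. s0 \<le> s \<and> (\<forall>t\<in>A. s \<le> t \<longrightarrow> dist (P s x) (P t x) < e)"
proof (rule ccontr)
  assume "\<not> ?thesis"
  then have "\<exists>\<sigma>. \<forall>n. (\<sigma> n \<in> A \<and> s0 \<le> \<sigma> n) \<and> (\<sigma> n \<le> \<sigma> (Suc n) \<and> dist (P (\<sigma> n) x) (P (\<sigma> (Suc n)) x) \<ge> e)"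
    using assms(2) by (intro dependent_nat_choice) (blast, meson not_less order_trans)
  then obtain \<sigma> where \<sigma>: "\<And>n. \<sigma> n \<in> A" "\<And>n. \<sigma> n \<le> \<sigma> (Suc n)"
    "\<And>n. dist (P (\<sigma> n) x) (P (\<sigma> (Suc n)) x) \<ge> e" by blast
  then have m: "mono \<sigma>" "range \<sigma> \<subseteq> G" using A(1) by (auto simp: mono_iff_le_Suc)
  then obtain s where "isLub UNIV (range \<sigma>) s" using sup_of_sequence by blast
  then have "(\<lambda>n. P (\<sigma> n) x) \<longlonglongrightarrow> P s x" using tendsto_P_lub_G m by blast
  then have "Cauchy (\<lambda>n. P (\<sigma> n) x)" by (rule LIMSEQ_imp_Cauchy)
  then obtain N where "\<forall>m\<ge>N. \<forall>n\<ge>N. dist (P (\<sigma> m) x) (P (\<sigma> n) x) < e"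
    using assms(1) unfolding Cauchy_def by blast
  then have "dist (P (\<sigma> N) x) (P (\<sigma> (Suc N)) x) < e" by simp
  with \<sigma>(3)[of N] show False by simp
qed

text \<open>A net without limit along \<open>A\<close> would oscillate along some increasing sequence in \<open>A\<close>, and
  there the projections converge to the projection at the supremum. This is why an uncountable
  directed set causes no trouble.\<close>

lemma limit_exists: "\<exists>l. ((\<lambda>s. P s x) \<longlongrightarrow> l) (tails A)"
proof -
  let ?close = "\<lambda>n s. \<forall>t\<in>A. s \<le> t \<longrightarrow> dist (P s x) (P t x) < inverse (real (Suc n))"
  have "\<exists>\<sigma>. \<forall>n. (\<sigma> n \<in> A \<and> ?close n (\<sigma> n)) \<and> \<sigma> n \<le> \<sigma> (Suc n)"
  proof (rule dependent_nat_choice)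
    show "\<exists>s. s \<in> A \<and> ?close 0 s"
      using tails_ex_close[of "inverse (real (Suc 0))"] A(3) by fastforce
    fix s n assume "s \<in> A \<and> ?close n s"
    then show "\<exists>t. (t \<in> A \<and> ?close (Suc n) t) \<and> s \<le> t"
      using tails_ex_close[of "inverse (real (Suc (Suc n)))" s] by fastforce
  qed
  then obtain \<sigma> where \<sigma>: "\<And>n. \<sigma> n \<in> A" "\<And>n. \<sigma> n \<le> \<sigma> (Suc n)"
    and close: "\<And>n t. t \<in> A \<Longrightarrow> \<sigma> n \<le> t \<Longrightarrow> dist (P (\<sigma> n) x) (P t x) < inverse (real (Suc n))"
    by blast
  then have m: "mono \<sigma>" "range \<sigma> \<subseteq> G" using A(1) by (auto simp: mono_iff_le_Suc)
  then obtain s where "isLub UNIV (range \<sigma>) s" using sup_of_sequence by blast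
  then have lim: "(\<lambda>n. P (\<sigma> n) x) \<longlonglongrightarrow> P s x" using tendsto_P_lub_G m by blast
  have "((\<lambda>s. P s x) \<longlongrightarrow> P s x) (tails A)"
  proof (rule tendstoI)
    fix e :: real assume "e > 0"
    then have "eventually (\<lambda>n. dist (P (\<sigma> n) x) (P s x) < e / 2) sequentially"
      using tendstoD[OF lim, of "e / 2"] by simp
    moreover have "eventually (\<lambda>n. inverse (real (Suc n)) < e / 2) sequentially"
      using order_tendstoD(2)[OF LIMSEQ_inverse_real_of_nat, of "e / 2"] \<open>e > 0\<close> by simp
    ultimately have "eventually (\<lambda>n. dist (P (\<sigma> n) x) (P s x) < e / 2 \<and> inverse (real (Suc n)) < e / 2) sequentially"
      by (rule eventually_conj)
    then obtain n where n: "dist (P (\<sigma> n) x) (P s x) < e / 2" "inverse (real (Suc n)) < e / 2"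
      by (auto simp: eventually_sequentially)
    have "dist (P t x) (P s x) < e" if "t \<in> A" "\<sigma> n \<le> t" for t
    proof -
      have "dist (P (\<sigma> n) x) (P t x) < e / 2"
        using close[OF that] n(2) by (rule order_less_trans)
      then show ?thesis
        using n(1) by (rule dist_triangle_half_r)
    qed
    then show "eventually (\<lambda>t. dist (P t x) (P s x) < e) (tails A)"
      using \<sigma>(1)[of n] by (auto simp: eventually_tails[OF A(2,3)])
  qed
  then show ?thesis by blast
qed

lemma limit_projection_eqI:
  assumes "((\<lambda>s. P s x) \<longlongrightarrow> l) (tails A)"
  shows "limit_projection P A x = l"
  using tendsto_Lim[OF tails_nontrivial[OF A(2,3)] assms] A(3) by (simp add: limit_projection_def)

lemma limit_projection_tendsto: "((\<lambda>s. P s x) \<longlongrightarrow> limit_projection P A x) (tails A)"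
proof -
  obtain l where l: "((\<lambda>s. P s x) \<longlongrightarrow> l) (tails A)" using limit_exists[of x] by blast
  then show ?thesis using limit_projection_eqI[OF l] by simp
qed

lemma norm_limit_projection_le: "norm (limit_projection P A x) \<le> K * norm x"
proof (rule tendsto_upperbound[OF tendsto_norm[OF limit_projection_tendsto]])
  show "eventually (\<lambda>s. norm (P s x) \<le> K * norm x) (tails A)"
    using A(1) norm_P_le by (intro eventually_tailsI[OF A(2,3)]) blast
qed (rule tails_nontrivial[OF A(2,3)])

lemma limit_projection_bounded_linear: "bounded_linear (limit_projection P A)"
proof (rule bounded_linear_intro)
  fix x y and r :: real
  show "limit_projection P A (x + y) = limit_projection P A x + limit_projection P A y"
    using tendsto_add[OF limit_projection_tendsto[of x] limit_projection_tendsto[of y]]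
    by (intro limit_projection_eqI) (simp add: bounded_linear.linear[OF P_bounded_linear] linear_add)
  show "limit_projection P A (r *\<^sub>R x) = r *\<^sub>R limit_projection P A x"
    using tendsto_scaleR[OF tendsto_const limit_projection_tendsto[of x], of r]
    by (intro limit_projection_eqI) (simp add: bounded_linear.linear[OF P_bounded_linear] linear_scale)
  show "norm (limit_projection P A x) \<le> norm x * K"
    using norm_limit_projection_le[of x] by (simp add: mult.commute)
qed

lemma limit_projection_smul: "limit_projection P A (smul c x) = smul c (limit_projection P A x)"
  using bounded_linear.tendsto[OF bounded_linear_smul limit_projection_tendsto[of x], of c]
  by (intro limit_projection_eqI) (simp add: P_smul)

lemma limit_projection_fixed:
  assumes "s \<in> A" "P s x = x"
  shows "limit_projection P A x = x"
proof (rule limit_projection_eqI[OF tendsto_eventually])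
  show "eventually (\<lambda>t. P t x = x) (tails A)"
    using eventually_tails_ge[OF A(2) assms(1)] by eventually_elim (use assms P_fixed_above in auto)
qed

lemma P_limit_projection:
  assumes "s \<in> A"
  shows "P s (limit_projection P A x) = P s x"
proof -
  have "((\<lambda>t. P s (P t x)) \<longlongrightarrow> P s x) (tails A)"
    by (rule tendsto_eventually)
      (use eventually_tails_ge[OF A(2) assms] in eventually_elim, simp add: P_below)
  moreover have "((\<lambda>t. P s (P t x)) \<longlongrightarrow> P s (limit_projection P A x)) (tails A)"
    by (rule bounded_linear.tendsto[OF P_bounded_linear limit_projection_tendsto])
  ultimately show ?thesis
    using tendsto_unique[OF tails_nontrivial[OF A(2,3)]] by blast
qed

lemma limit_projection_commute:
  assumes R: "bounded_linear R" and comm: "\<And>s x. s \<in> A \<Longrightarrow> P s (R x) = R (P s x)"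
  shows "limit_projection P A (R x) = R (limit_projection P A x)"
proof (rule limit_projection_eqI)
  have "((\<lambda>s. R (P s x)) \<longlongrightarrow> R (limit_projection P A x)) (tails A)"
    by (rule bounded_linear.tendsto[OF R limit_projection_tendsto])
  moreover have "eventually (\<lambda>s. R (P s x) = P s (R x)) (tails A)"
    using comm by (intro eventually_tailsI[OF A(2,3)]) simp
  ultimately show "((\<lambda>s. P s (R x)) \<longlongrightarrow> R (limit_projection P A x)) (tails A)"
    by (rule Lim_transform_eventually)
qed

lemma limit_projection_range: "range (limit_projection P A) \<subseteq> closure (\<Union>s\<in>A. range (P s))"
proof clarify
  fix x
  have "eventually (\<lambda>s. P s x \<in> closure (\<Union>s\<in>A. range (P s))) (tails A)"
    by (rule eventually_tailsI[OF A(2,3)], rule subsetD[OF closure_subset]) blast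
  then show "limit_projection P A x \<in> closure (\<Union>s\<in>A. range (P s))"
    by (rule Lim_in_closed_set[OF closed_closure _ tails_nontrivial[OF A(2,3)] limit_projection_tendsto])
qed

end

text \<open>Both identities hold for the members of the net and pass to the limit.\<close>

lemma limit_projection_nested:
  assumes A: "A \<subseteq> B" "directed A" "A \<noteq> {}" and B: "B \<subseteq> G" "directed B"
  shows "limit_projection P A (limit_projection P B x) = limit_projection P A x"
    and "limit_projection P B (limit_projection P A x) = limit_projection P A x"
proof -
  have A': "A \<subseteq> G" "directed A" "A \<noteq> {}" and B': "B \<subseteq> G" "directed B" "B \<noteq> {}" using A B by auto
  have "eventually (\<lambda>s. P s x = P s (limit_projection P B x)) (tails A)"
    using P_limit_projection[OF B'] A(1) by (intro eventually_tailsI[OF A(2,3)]) (simp add: subset_iff)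
  then show "limit_projection P A (limit_projection P B x) = limit_projection P A x"
    by (intro limit_projection_eqI[OF A'] Lim_transform_eventually[OF limit_projection_tendsto[OF A']])
  have "limit_projection P B (P s x) = P s x" if "s \<in> A" for s
    using that A(1) by (intro limit_projection_fixed[OF B' _ P_idem]) blast
  then have "eventually (\<lambda>s. limit_projection P B (P s x) = P s x) (tails A)"
    by (rule eventually_tailsI[OF A(2,3)])
  with bounded_linear.tendsto[OF limit_projection_bounded_linear[OF B'] limit_projection_tendsto[OF A']]
  have "((\<lambda>s. P s x) \<longlongrightarrow> limit_projection P B (limit_projection P A x)) (tails A)"
    by (rule Lim_transform_eventually)
  from limit_projection_eqI[OF A' this]
  show "limit_projection P B (limit_projection P A x) = limit_projection P A x" by (rule sym)
qed

lemma limit_projection_idem: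
  assumes "A \<subseteq> G" "directed A" "A \<noteq> {}"
  shows "limit_projection P A (limit_projection P A x) = limit_projection P A x"
  by (rule limit_projection_nested(1)[OF order_refl assms(2,3,1,2)])

end

section \<open>Operators continuous for the topology of the induced subspace\<close>

context banach_over
begin

lemma eq_on_dense_span:
  assumes dense: "closure (local.span M) = UNIV"
    and f: "bounded_linear f" and g: "bounded_linear g"
    and scale: "\<And>c x. f x = g x \<Longrightarrow> f (smul c x) = g (smul c x)"
    and eq: "\<And>x. x \<in> M \<Longrightarrow> f x = g x"
  shows "f x = g x"
proof -
  have "local.subspace {x. f x = g x}"
    using f g scale
    by (auto simp: subspace_def bounded_linear.linear linear_add linear_0)
  then have "local.span M \<subseteq> {x. f x = g x}"
    using eq by (intro span_minimal) auto
  moreover have "closed {x. f x = g x}"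
    by (rule closed_Collect_eq[OF linear_continuous_on[OF f] linear_continuous_on[OF g]])
  ultimately have "closure (local.span M) \<subseteq> {x. f x = g x}"
    by (rule closure_minimal)
  then show ?thesis using dense by auto
qed

end

context projectional_skeleton
begin

lemma D_subset_dual: "f \<in> D \<Longrightarrow> f \<in> dual_space smul"
  by (simp add: mem_D_iff)

lemma D_diff:
  assumes "f \<in> D" "g \<in> D"
  shows "(\<lambda>x. f x - g x) \<in> D"
proof -
  obtain s t where s: "\<And>x. f (P s x) = f x" and t: "\<And>x. g (P t x) = g x"
    using assms unfolding mem_D_iff by blast
  obtain u where u: "s \<le> u" "t \<le> u"
    using up_directed by (auto simp: directed_def)
  have "f (P u x) - g (P u x) = f x - g x" for x
    using mem_D_above[of f, OF s u(1)] mem_D_above[of g, OF t u(2)] by simp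
  moreover have "(\<lambda>x. f x - g x) \<in> dual_space smul"
    using assms by (auto simp: mem_D_iff dual_space_iff bounded_linear_sub right_diff_distrib)
  ultimately show ?thesis by (auto simp: mem_D_iff)
qed

text \<open>The weakly continuous operators, described through the functionals in \<open>D\<close>; this form composes well and
  is the one in which the continuity hypothesis is used.\<close>

definition D_operator :: "('a \<Rightarrow> 'a) \<Rightarrow> bool" where
  "D_operator R \<longleftrightarrow> bounded_linear R \<and> (\<forall>c x. R (smul c x) = smul c (R x)) \<and>
     (\<forall>f\<in>D. (\<lambda>x. f (R x)) \<in> D)"

lemma D_operator_bounded_linear: "D_operator R \<Longrightarrow> bounded_linear R"
  and D_operator_comp_mem_D: "D_operator R \<Longrightarrow> f \<in> D \<Longrightarrow> (\<lambda>x. f (R x)) \<in> D"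
  by (auto simp: D_operator_def)

lemma D_operator_id: "D_operator (\<lambda>x. x)"
  by (simp add: D_operator_def bounded_linear_ident)

lemma D_operator_comp: "D_operator R \<Longrightarrow> D_operator S \<Longrightarrow> D_operator (\<lambda>x. R (S x))"
  by (auto simp: D_operator_def intro: bounded_linear_compose)

lemma D_operator_diff:
  assumes "D_operator R" "D_operator S"
  shows "D_operator (\<lambda>x. R x - S x)"
proof -
  have "(\<lambda>x. f (R x - S x)) \<in> D" if "f \<in> D" for f
    using D_diff[of "\<lambda>x. f (R x)" "\<lambda>x. f (S x)"] assms that
      dual_space_bounded_linear[OF D_subset_dual[OF that]]
    by (simp add: D_operator_def bounded_linear.linear linear_diff)
  with assms show ?thesis
    by (simp add: D_operator_def bounded_linear_sub scale_right_diff_distrib)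
qed

lemma topspace_weak_topology:
  assumes "f \<in> E"
  shows "topspace (weak_topology E) = UNIV"
proof -
  have "f -` UNIV \<subseteq> \<Union> {f -` U | f U. f \<in> E \<and> open U}"
    using assms by blast
  then show ?thesis
    by (simp add: weak_topology_def topology_generated_by_topspace top.extremum_unique)
qed

lemma zero_mem_D: "(\<lambda>x. 0) \<in> D"
  by (simp add: mem_D_iff dual_space_iff bounded_linear_zero)

lemma weak_neighbourhood_of_0:
  assumes "openin (weak_topology D) W" "0 \<in> W"
  obtains s where "\<And>x. P s x = 0 \<Longrightarrow> x \<in> W"
proof -
  have "generate_topology_on {f -` U | f U. f \<in> D \<and> open U} W"
    using assms(1) by (simp add: weak_topology_def openin_topology_generated_by_iff)
  then have "0 \<in> W \<longrightarrow> (\<exists>s. \<forall>x. P s x = 0 \<longrightarrow> x \<in> W)"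
  proof induction
    case (Int a b)
    show ?case
    proof
      assume "0 \<in> a \<inter> b"
      then obtain s t where st: "\<And>x. P s x = 0 \<Longrightarrow> x \<in> a" "\<And>x. P t x = 0 \<Longrightarrow> x \<in> b"
        using Int.IH by blast
      obtain u where u: "s \<le> u" "t \<le> u"
        using up_directed by (auto simp: directed_def)
      have "x \<in> a \<inter> b" if "P u x = 0" for x
      proof -
        have "P s (P u x) = 0" "P t (P u x) = 0"
          using P_diff[of s 0 0] P_diff[of t 0 0] that by auto
        then show ?thesis using st P_below(1) u by auto
      qed
      then show "\<exists>s. \<forall>x. P s x = 0 \<longrightarrow> x \<in> a \<inter> b" by blast
    qed
  next
    case (UN \<K>)
    then show ?case by blast
  next
    case (Basis W)
    then obtain f U where f: "W = f -` U" "f \<in> D" by blast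
    then obtain s where s: "\<And>x. f (P s x) = f x" by (auto simp: mem_D_iff)
    have "f x = f 0" if "P s x = 0" for x
      using s[of x] that by simp
    then show ?case using f by (auto intro!: exI[of _ s])
  qed simp
  then show ?thesis using assms(2) that by blast
qed

text \<open>Every weak neighbourhood of \<open>0\<close> contains the kernel of a single \<open>P s\<close>, since finitely many
  functionals in \<open>D\<close> factor through a common \<open>P s\<close>. A weakly continuous functional is bounded by \<open>1\<close>
  on such a neighbourhood, so it vanishes on that kernel and factors through \<open>P s\<close> as well.\<close>

lemma D_operator_if_continuous:
  assumes R: "bounded_linear R" "\<And>c x. R (smul c x) = smul c (R x)"
    and cont: "continuous_map (weak_topology D) (weak_topology D) R"
  shows "D_operator R"
proof -
  have "(\<lambda>x. f (R x)) \<in> D" if "f \<in> D" for f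
  proof -
    define g where "g x = f (R x)" for x
    have f: "f \<in> dual_space smul" using that by (rule D_subset_dual)
    then have g: "g \<in> dual_space smul"
      using R unfolding g_def dual_space_iff by (auto intro: bounded_linear_compose)
    then interpret g: bounded_linear g by (rule dual_space_bounded_linear)
    have "openin (weak_topology D) (f -` ball 0 1)"
      unfolding weak_topology_def using that by (intro topology_generated_by_Basis) blast
    from openin_continuous_map_preimage[OF cont this]
    have "openin (weak_topology D) {x. norm (g x) < 1}"
      by (simp add: g_def topspace_weak_topology[OF that])
    then obtain s where s: "\<And>x. P s x = 0 \<Longrightarrow> norm (g x) < 1"
      by (rule weak_neighbourhood_of_0) (auto simp: g.zero)
    have "g x = 0" if "P s x = 0" for x
    proof (rule ccontr)
      assume "g x \<noteq> 0"
      have "P s ((1 / norm (g x)) *\<^sub>R x) = 0"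
        using that by (simp add: bounded_linear.linear[OF P_bounded_linear] linear_scale)
      from s[OF this] \<open>g x \<noteq> 0\<close> show False by (simp add: g.scaleR)
    qed
    from this[of "x - P s x" for x] have "g (P s x) = g x" for x
      by (simp add: P_diff P_idem g.diff)
    then have "g \<in> D" using g by (auto simp: mem_D_iff)
    then show ?thesis by (simp add: g_def[abs_def])
  qed
  with R show ?thesis by (simp add: D_operator_def)
qed

lemma continuous_if_D_operator:
  assumes "D_operator R"
  shows "continuous_map (weak_topology D) (weak_topology D) R"
proof -
  have top: "topspace (weak_topology D) = UNIV"
    using topspace_weak_topology zero_mem_D by blast
  have "openin (weak_topology D) (R -` f -` U)" if "f \<in> D" "open U" for f U
  proof -
    have "R -` f -` U = (\<lambda>x. f (R x)) -` U" by auto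
    then show ?thesis
      unfolding weak_topology_def using D_operator_comp_mem_D[OF assms that(1)] that(2)
      by (intro topology_generated_by_Basis) blast
  qed
  moreover have "\<Union> {f -` U | f U. f \<in> D \<and> open U} = UNIV"
    using top unfolding weak_topology_def topology_generated_by_topspace .
  ultimately show ?thesis
    using top unfolding weak_topology_def continuous_on_generated_topo_iff by auto
qed

end

context bounded_skeleton
begin

text \<open>For \<open>f = f \<circ> P s\<close> the limit projection can be moved past \<open>P s\<close>: \<open>f (L x) = f (P s (L x)) = f (L (P s x))\<close>.\<close>

lemma commuting_limit_projection_D_operator:
  assumes comm: "\<And>s t x. s \<in> G \<Longrightarrow> t \<in> G \<Longrightarrow> P s (P t x) = P t (P s x)"
    and A: "A \<subseteq> G" "directed A" "A \<noteq> {}"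
  shows "D_operator (limit_projection P A)"
proof -
  let ?L = "limit_projection P A"
  have L: "bounded_linear ?L" by (rule limit_projection_bounded_linear[OF A])
  have "(\<lambda>x. f (?L x)) \<in> D" if f: "f \<in> D" for f
  proof -
    have dual: "f \<in> dual_space smul" using f by (rule D_subset_dual)
    obtain s0 where s0: "\<And>x. f (P s0 x) = f x" using f unfolding mem_D_iff by blast
    obtain s where s: "s \<in> G" "s0 \<le> s" by (rule G_above)
    have "?L (P s x) = P s (?L x)" for x
      using comm s A(1) by (intro limit_projection_commute[OF A P_bounded_linear]) blast
    then have "f (?L (P s x)) = f (?L x)" for x
      using mem_D_above[of f, OF s0 s(2)] by simp
    moreover have "(\<lambda>x. f (?L x)) \<in> dual_space smul"
      using dual bounded_linear_compose[OF dual_space_bounded_linear[OF dual] L]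
      by (simp add: dual_space_iff limit_projection_smul[OF A])
    ultimately show ?thesis unfolding mem_D_iff by blast
  qed
  then show ?thesis
    using L limit_projection_smul[OF A] by (simp add: D_operator_def)
qed

text \<open>One step of the closing-off argument below: both conditions concern only separable data, namely
  a countable dense subset of \<open>range (P s)\<close> and a countable separating family of functionals on it.\<close>

lemma commuting_step:
  assumes s: "s \<in> G" and N: "countable N" "\<And>R. R \<in> N \<Longrightarrow> D_operator R"
  shows "\<exists>t\<in>G. s \<le> t \<and> (\<forall>R\<in>N. \<forall>x. P t (R (P s x)) = R (P s x) \<and> P s (R (P t x)) = P s (R x))"
proof -
  obtain d where d: "countable d" "d \<subseteq> range (P s)" "range (P s) \<subseteq> closure d"
    by (rule countable_dense_in_range)
  obtain F where F: "countable F" "F \<subseteq> dual_space smul"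
    and sep: "\<And>y. y \<in> closure d \<Longrightarrow> (\<And>f. f \<in> F \<Longrightarrow> f y = 0) \<Longrightarrow> y = 0"
    using countable_separating_functionals[OF d(1)] by blast
  have "\<exists>u. \<forall>x. f (P s (R (P u x))) = f (P s (R x))" if "f \<in> F" "R \<in> N" for f R
  proof -
    have "(\<lambda>x. f (P s x)) \<in> D" using that F(2) by (intro mem_dual_comp_P) blast
    from D_operator_comp_mem_D[OF N(2)[OF that(2)] this] show ?thesis
      unfolding mem_D_iff by blast
  qed
  then obtain u where u: "\<And>f R x. f \<in> F \<Longrightarrow> R \<in> N \<Longrightarrow> f (P s (R (P (u f R) x))) = f (P s (R x))"
    by metis
  have "countable (\<Union>R\<in>N. R ` d)" "countable (insert s (\<Union>f\<in>F. u f ` N))"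
    using N(1) d(1) F(1) by auto
  then obtain t where t: "t \<in> G" "\<And>a. a \<in> insert s (\<Union>f\<in>F. u f ` N) \<Longrightarrow> a \<le> t"
    and fix_t: "\<And>x. x \<in> closure (\<Union>R\<in>N. R ` d) \<Longrightarrow> P t x = x"
    by (rule separable_set_in_range_P) blast
  have "P t (R (P s x)) = R (P s x) \<and> P s (R (P t x)) = P s (R x)" if R: "R \<in> N" for R x
  proof
    have lin: "bounded_linear R" using N(2)[OF R] by (rule D_operator_bounded_linear)
    have "P s x \<in> closure d" using d(3) by blast
    then have "R (P s x) \<in> closure (R ` d)"
      using closure_bounded_linear_image_subset[OF lin, of d] by blast
    moreover have "closure (R ` d) \<subseteq> closure (\<Union>R\<in>N. R ` d)"
      using R by (intro closure_mono) blast
    ultimately show "P t (R (P s x)) = R (P s x)" using fix_t by blast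
    have "P s (R (P t x)) - P s (R x) = 0"
    proof (rule sep)
      show "P s (R (P t x)) - P s (R x) \<in> closure d"
        using d(3) P_diff[of s "R (P t x)" "R x"] by (metis rangeI subsetD)
      fix f assume f: "f \<in> F"
      then have "u f R \<le> t" using t(2) R by blast
      then have "f (P s (R (P t x))) = f (P s (R x))"
        using u[OF f R, of "P t x"] u[OF f R, of x] by (simp add: P_below(1))
      moreover have "bounded_linear f" using f F(2) dual_space_bounded_linear by blast
      ultimately show "f (P s (R (P t x)) - P s (R x)) = 0"
        by (simp add: bounded_linear.linear linear_diff)
    qed
    then show "P s (R (P t x)) = P s (R x)" by simp
  qed
  then show ?thesis using t by blast
qed

text \<open>Whether \<open>P s\<close> commutes with an operator is a question that can be closed off: along an increasing
  sequence with \<open>R (P (\<sigma> n) x)\<close> in the range of \<open>P (\<sigma> (n + 1))\<close>, and the dual condition, both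
  \<open>P s \<circ> R \<circ> P s = R \<circ> P s\<close> and \<open>P s \<circ> R \<circ> P s = P s \<circ> R\<close> hold at the supremum. The family of operators
  is allowed to grow with the index, so that \<open>P s\<close> can be made to commute with operators which are
  selected by \<open>P s\<close> itself.\<close>

lemma commuting_index_above:
  fixes N :: "'i \<Rightarrow> ('a \<Rightarrow> 'a) set"
  assumes s0: "s0 \<in> G"
    and countable_N: "\<forall>s. countable (N s)" and D_operator_N: "\<forall>s. \<forall>R\<in>N s. D_operator R"
    and mono_N: "\<forall>s t. s \<le> t \<longrightarrow> N s \<subseteq> N t"
  obtains \<sigma> :: "nat \<Rightarrow> 'i" and s where "s \<in> G" "s0 \<le> s" "\<And>x. (\<lambda>n. P (\<sigma> n) x) \<longlonglongrightarrow> P s x"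
    "\<And>n R x. R \<in> N (\<sigma> n) \<Longrightarrow> P s (R x) = R (P s x)"
proof -
  have N: "\<And>s. countable (N s)" "\<And>s R. R \<in> N s \<Longrightarrow> D_operator R" "\<And>s t. s \<le> t \<Longrightarrow> N s \<subseteq> N t"
    using countable_N D_operator_N mono_N by auto
  let ?\<phi> = "\<lambda>s t. \<forall>R\<in>N s. \<forall>x. P t (R (P s x)) = R (P s x) \<and> P s (R (P t x)) = P s (R x)"
  have "\<forall>s\<in>G. \<exists>t\<in>G. s \<le> t \<and> ?\<phi> s t"
    using commuting_step[OF _ N(1) N(2)] by simp
  with sigma_closed_G s0 obtain \<sigma> :: "nat \<Rightarrow> 'i" and s where \<sigma>: "mono \<sigma>" "\<sigma> 0 = s0"
    "range \<sigma> \<subseteq> G" "\<And>n. ?\<phi> (\<sigma> n) (\<sigma> (Suc n))" "isLub UNIV (range \<sigma>) s" "s \<in> G"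
    by (rule closing_off_sequence) (rule that)
  have le_s: "\<sigma> n \<le> s" for n using isLubD2[OF \<sigma>(5)] by blast
  have lim: "(\<lambda>n. P (\<sigma> n) x) \<longlonglongrightarrow> P s x" for x
    using \<sigma>(1,3,5) by (rule tendsto_P_lub_G)
  have "P s (R x) = R (P s x)" if R: "R \<in> N (\<sigma> n)" for n R x
  proof -
    have lin: "bounded_linear R" using N(2)[OF R] by (rule D_operator_bounded_linear)
    have Rm: "R \<in> N (\<sigma> m)" if "m \<ge> n" for m
      using R N(3) monoD[OF \<sigma>(1) that] by blast
    have step: "P s (R (P (\<sigma> m) x)) = R (P (\<sigma> m) x)" "P (\<sigma> m) (R (P s x)) = P (\<sigma> m) (R x)"
      if "m \<ge> n" for m
    proof -
      have 1: "P (\<sigma> (Suc m)) (R (P (\<sigma> m) x)) = R (P (\<sigma> m) x)"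
        and 2: "\<And>x. P (\<sigma> m) (R (P (\<sigma> (Suc m)) x)) = P (\<sigma> m) (R x)"
        using \<sigma>(4) Rm[OF that] by blast+
      show "P s (R (P (\<sigma> m) x)) = R (P (\<sigma> m) x)"
        using P_fixed_above[OF le_s 1] .
      show "P (\<sigma> m) (R (P s x)) = P (\<sigma> m) (R x)"
        using 2[of "P s x"] 2[of x] by (simp add: P_below(1)[OF le_s])
    qed
    have "P s (R (P s x)) = R (P s x)"
    proof (rule LIMSEQ_unique)
      show "(\<lambda>m. R (P (\<sigma> m) x)) \<longlonglongrightarrow> R (P s x)"
        by (rule bounded_linear.tendsto[OF lin lim])
      show "(\<lambda>m. R (P (\<sigma> m) x)) \<longlonglongrightarrow> P s (R (P s x))"
        using bounded_linear.tendsto[OF P_bounded_linear bounded_linear.tendsto[OF lin lim[of x]], of s]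
        by (rule Lim_transform_eventually) (use step(1) in \<open>auto simp: eventually_sequentially\<close>)
    qed
    moreover have "P s (R (P s x)) = P s (R x)"
    proof (rule LIMSEQ_unique)
      show "(\<lambda>m. P (\<sigma> m) (R x)) \<longlonglongrightarrow> P s (R x)" by (rule lim)
      show "(\<lambda>m. P (\<sigma> m) (R x)) \<longlonglongrightarrow> P s (R (P s x))"
        using lim[of "R (P s x)"]
        by (rule Lim_transform_eventually) (use step(2) in \<open>auto simp: eventually_sequentially\<close>)
    qed
    ultimately show ?thesis by simp
  qed
  moreover have "s0 \<le> s" using le_s[of 0] \<sigma>(2) by simp
  ultimately show ?thesis using that \<sigma>(6) lim by blast
qed

section \<open>Sigma-subspaces and commuting projections\<close>

text \<open>Countably many functionals \<open>f \<circ> P s \<in> D\<close> detect whether \<open>P s x\<close> is nonzero, and each of them is nonzero at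
  only countably many points of \<open>M\<close>.\<close>

lemma countable_P_support:
  assumes M: "\<And>f. f \<in> D \<Longrightarrow> countable {x\<in>M. f x \<noteq> 0}"
  shows "countable {x\<in>M. P s x \<noteq> 0}"
proof -
  obtain d where d: "countable d" "d \<subseteq> range (P s)" "range (P s) \<subseteq> closure d"
    by (rule countable_dense_in_range)
  obtain F where F: "countable F" "F \<subseteq> dual_space smul"
    and sep: "\<And>y. y \<in> closure d \<Longrightarrow> (\<And>f. f \<in> F \<Longrightarrow> f y = 0) \<Longrightarrow> y = 0"
    using countable_separating_functionals[OF d(1)] by blast
  have "{x\<in>M. P s x \<noteq> 0} \<subseteq> (\<Union>f\<in>F. {x\<in>M. f (P s x) \<noteq> 0})"
    using sep d(3) by blast
  moreover have "countable (\<Union>f\<in>F. {x\<in>M. f (P s x) \<noteq> 0})"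
    using F M mem_dual_comp_P by (intro countable_UN) (auto dest!: subsetD)
  ultimately show ?thesis by (rule countable_subset)
qed

definition splitting_indices :: "'a set \<Rightarrow> 'i set" where
  "splitting_indices M = {s \<in> G. \<forall>x\<in>M. P s x = 0 \<or> P s x = x}"

lemma P_limit_of_splitting:
  fixes \<sigma> :: "nat \<Rightarrow> 'i"
  assumes \<sigma>: "mono \<sigma>" "range \<sigma> \<subseteq> G" "isLub UNIV (range \<sigma>) s"
    and step: "\<And>n. \<exists>m. P (\<sigma> n) x = 0 \<or> P (\<sigma> m) x = x"
  shows "P s x = 0 \<or> P s x = x"
proof (cases "\<forall>n. P (\<sigma> n) x = 0")
  case True
  then have "(\<lambda>n. 0) \<longlonglongrightarrow> P s x" using tendsto_P_lub_G[OF \<sigma>, of x] by simp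
  then show ?thesis by (simp add: LIMSEQ_const_iff)
next
  case False
  then obtain m where "P (\<sigma> m) x = x" using step by blast
  moreover have "\<sigma> m \<le> s" using isLubD2[OF \<sigma>(3)] by blast
  ultimately show ?thesis using P_fixed_above by blast
qed

lemma sigma_closed_splitting: "sigma_closed (splitting_indices M)"
  unfolding sigma_closed_def
proof (intro allI impI)
  fix \<sigma> :: "nat \<Rightarrow> 'i" and s
  assume \<sigma>: "mono \<sigma>" "range \<sigma> \<subseteq> splitting_indices M" "isLub UNIV (range \<sigma>) s"
  then have G: "range \<sigma> \<subseteq> G" by (auto simp: splitting_indices_def)
  then have "s \<in> G" using \<sigma> sigma_closed_G unfolding sigma_closed_def by blast
  moreover have "P s x = 0 \<or> P s x = x" if "x \<in> M" for x
    using \<sigma>(2) that by (intro P_limit_of_splitting[OF \<sigma>(1) G \<sigma>(3)]) (auto simp: splitting_indices_def)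
  ultimately show "s \<in> splitting_indices M" by (simp add: splitting_indices_def)
qed

text \<open>Close off so that the points of \<open>M\<close> not killed by one projection are fixed by the next one. If
  \<open>P s x \<noteq> 0\<close> at the supremum, then \<open>P (\<sigma> n) x \<noteq> 0\<close> for some \<open>n\<close>, hence \<open>x\<close> is fixed from then on.\<close>

lemma cofinal_splitting:
  assumes M: "\<And>f. f \<in> D \<Longrightarrow> countable {x\<in>M. f x \<noteq> 0}"
  shows "cofinal_subset (splitting_indices M)"
  unfolding cofinal_subset_def
proof
  fix r
  obtain s0 where s0: "s0 \<in> G" "r \<le> s0" by (rule G_above)
  let ?\<phi> = "\<lambda>s t. \<forall>x\<in>M. P s x \<noteq> 0 \<longrightarrow> P t x = x"
  have "\<forall>s\<in>G. \<exists>t\<in>G. s \<le> t \<and> ?\<phi> s t"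
  proof
    fix s assume "s \<in> G"
    have "countable {x\<in>M. P s x \<noteq> 0}" "countable {s}"
      using countable_P_support[OF M] by auto
    then obtain t where "t \<in> G" "\<And>a. a \<in> {s} \<Longrightarrow> a \<le> t"
      "\<And>x. x \<in> closure {x\<in>M. P s x \<noteq> 0} \<Longrightarrow> P t x = x"
      by (rule separable_set_in_range_P) blast
    then show "\<exists>t\<in>G. s \<le> t \<and> ?\<phi> s t" using closure_subset[of "{x\<in>M. P s x \<noteq> 0}"] by blast
  qed
  with sigma_closed_G s0(1) obtain \<sigma> :: "nat \<Rightarrow> 'i" and s where \<sigma>: "mono \<sigma>" "\<sigma> 0 = s0"
    "range \<sigma> \<subseteq> G" "\<And>n. ?\<phi> (\<sigma> n) (\<sigma> (Suc n))" "isLub UNIV (range \<sigma>) s" "s \<in> G"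
    by (rule closing_off_sequence) (rule that)
  have "P s x = 0 \<or> P s x = x" if "x \<in> M" for x
    using \<sigma>(4) that by (intro P_limit_of_splitting[OF \<sigma>(1,3,5)]) blast
  moreover have "r \<le> s"
    using isLubD2[OF \<sigma>(5), of s0] \<sigma>(2) s0(2) by (metis order_trans rangeI)
  ultimately show "\<exists>t\<in>splitting_indices M. r \<le> t"
    using \<sigma>(6) by (auto simp: splitting_indices_def)
qed

lemma splitting_projections_commute:
  assumes dense: "closure (local.span M) = UNIV"
    and s: "s \<in> splitting_indices M" and t: "t \<in> splitting_indices M"
  shows "P s (P t x) = P t (P s x)"
proof (rule eq_on_dense_span[where f = "\<lambda>x. P s (P t x)" and g = "\<lambda>x. P t (P s x)", OF dense])
  show "bounded_linear (\<lambda>x. P s (P t x))" "bounded_linear (\<lambda>x. P t (P s x))"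
    by (intro bounded_linear_compose[OF P_bounded_linear P_bounded_linear])+
  have 0: "P s 0 = 0" for s using P_diff[of s 0 0] by simp
  fix x assume "x \<in> M"
  then have "P s x = 0 \<or> P s x = x" "P t x = 0 \<or> P t x = x"
    using s t by (auto simp: splitting_indices_def)
  then show "P s (P t x) = P t (P s x)" by (auto simp: 0)
qed (simp add: P_smul)

text \<open>A functional \<open>f\<close> whose support in \<open>M\<close> is countable factors through some \<open>P t\<close> automatically: choose
  a splitting index \<open>t\<close> such that the range of \<open>P t\<close> contains that support. So only one inclusion has
  to be checked.\<close>

lemma Sigma_subspaceI:
  assumes dense: "closure (local.span M) = UNIV"
    and M: "\<And>f. f \<in> D \<Longrightarrow> countable {x\<in>M. f x \<noteq> 0}"
  shows "Sigma_subspace smul D"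
proof -
  have "f \<in> D" if f: "f \<in> dual_space smul" "countable {x\<in>M. f x \<noteq> 0}" for f
  proof -
    obtain s where s: "\<And>x. x \<in> closure {x\<in>M. f x \<noteq> 0} \<Longrightarrow> P s x = x"
      by (rule separable_set_in_range_P[OF f(2) countable_empty]) blast
    obtain t where t: "t \<in> splitting_indices M" "s \<le> t"
      using cofinal_splitting[OF M] by (auto simp: cofinal_subset_def)
    have lin: "bounded_linear f" using f(1) by (rule dual_space_bounded_linear)
    have "f (P t x) = f x" for x
    proof (rule eq_on_dense_span[OF dense bounded_linear_compose[OF lin P_bounded_linear] lin])
      fix x assume x: "x \<in> M"
      show "f (P t x) = f x"
      proof (cases "f x = 0")
        case True
        then show ?thesis
          using t(1) x lin by (auto simp: splitting_indices_def bounded_linear.linear linear_0)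
      next
        case False
        then have "x \<in> {x\<in>M. f x \<noteq> 0}" using x by simp
        then have "P s x = x" by (rule s[OF subsetD[OF closure_subset]])
        then show ?thesis using P_fixed_above[OF t(2)] by simp
      qed
    qed (use f(1) in \<open>simp add: P_smul dual_space_iff\<close>)
    then show ?thesis using f(1) by (auto simp: mem_D_iff)
  qed
  then have "D = {f \<in> dual_space smul. countable {x\<in>M. f x \<noteq> 0}}"
    using M D_subset_dual by (intro set_eqI iffI) simp_all
  then show ?thesis using dense unfolding Sigma_subspace_def by blast
qed

end

unbundle cardinal_syntax

section \<open>Well-ordered resolutions\<close>

lemma countable_ordLeq_infinite:
  assumes "countable A" "infinite B"
  shows "|A| \<le>o |B|"
proof -
  have "|A| \<le>o |UNIV :: nat set|"
    using assms(1) by (auto simp: countable_def card_of_ordLeq[symmetric])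
  moreover have "|UNIV :: nat set| \<le>o |B|"
    using assms(2) by (simp add: infinite_iff_card_of_nat)
  ultimately show ?thesis by (rule ordLeq_transitive)
qed

lemma card_of_finite_subsets:
  assumes "infinite T"
  shows "|{F. finite F \<and> F \<subseteq> T}| \<le>o |T|"
proof -
  let ?L = "\<lambda>n. {xs. set xs \<subseteq> T \<and> length xs = n}"
  have L: "|?L n| \<le>o |T|" for n
  proof (induction n)
    case 0
    have "?L 0 = {[]}" by auto
    then show ?case using assms by (simp add: countable_ordLeq_infinite)
  next
    case (Suc n)
    have "?L (Suc n) \<subseteq> (\<lambda>(x, xs). x # xs) ` (T \<times> ?L n)"
      by (auto simp: length_Suc_conv)
    then have "|?L (Suc n)| \<le>o |T \<times> ?L n|"
      by (rule surj_imp_ordLeq)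
    moreover have "|T \<times> ?L n| \<le>o |T|"
      using assms Suc by (intro card_of_Sigma_ordLeq_infinite card_of_mono1) auto
    ultimately show ?case by (rule ordLeq_transitive)
  qed
  have "{F. finite F \<and> F \<subseteq> T} \<subseteq> set ` (\<Union>n. ?L n)"
    by (auto simp: image_iff) (metis finite_list)
  then have "|{F. finite F \<and> F \<subseteq> T}| \<le>o |\<Union>n. ?L n|"
    by (rule surj_imp_ordLeq)
  moreover have "|\<Union>n. ?L n| \<le>o |T|"
    using assms L by (intro card_of_UNION_ordLeq_infinite) (auto simp: infinite_iff_card_of_nat)
  ultimately show ?thesis by (rule ordLeq_transitive)
qed

lemma countable_ordLess_uncountable:
  assumes "countable A" "uncountable B"
  shows "|A| <o |B|"
proof -
  have "\<not> |B| \<le>o |A|"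
  proof
    assume "|B| \<le>o |A|"
    then obtain f where "inj_on f B" "f ` B \<subseteq> A"
      using card_of_ordLeq[of B A] by blast
    then show False
      using assms by (metis countable_image_inj_on countable_subset)
  qed
  then show ?thesis
    using not_ordLeq_iff_ordLess[OF card_of_Well_order card_of_Well_order] by blast
qed

text \<open>This is the density bound for the ranges of the steps: \<open>A\<close> will be a proper initial segment of \<open>B\<close> and
  \<open>d F\<close> a countable dense subset of the range of one projection.\<close>

lemma card_of_finitely_indexed_union:
  assumes A: "|A| <o |B|" and B: "uncountable B"
    and d: "\<And>F. finite F \<Longrightarrow> countable (d F)"
  shows "|\<Union>F\<in>{F. finite F \<and> F \<subseteq> insert a A}. d F| <o |B|"
proof (cases "finite A")
  case True
  then have "finite (Pow (insert a A))" by simp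
  then have "finite {F. finite F \<and> F \<subseteq> insert a A}"
    by (rule finite_subset[rotated]) auto
  then have "countable (\<Union>F\<in>{F. finite F \<and> F \<subseteq> insert a A}. d F)"
    by (rule countable_UN[OF countable_finite]) (simp add: d)
  then show ?thesis using B by (rule countable_ordLess_uncountable)
next
  case False
  have "|insert a A| \<le>o |A|"
  proof -
    have "|{a}| \<le>o |A|"
      using False by (intro countable_ordLeq_infinite) auto
    then have "|{a} \<union> A| \<le>o |A|"
      using False card_of_Un_ordLeq_infinite_Field[of "|A|" "{a}" A]
      by (simp add: Field_card_of card_of_card_order_on card_of_mono1)
    then show ?thesis by simp
  qed
  then have "|{F. finite F \<and> F \<subseteq> insert a A}| \<le>o |A|"
    using card_of_finite_subsets[of "insert a A"] False ordLeq_transitive by auto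
  moreover have "|d F| \<le>o |A|" if "finite F" for F
    using d[OF that] False by (rule countable_ordLeq_infinite)
  ultimately have "|\<Union>F\<in>{F. finite F \<and> F \<subseteq> insert a A}. d F| \<le>o |A|"
    using False by (intro card_of_UNION_ordLeq_infinite) auto
  then show ?thesis using A by (rule ordLeq_ordLess_trans)
qed

text \<open>A family of operators indexed by the subsets of a well-ordered set that is determined by finite
  subsets: no continuity at limits has to be built in by a transfinite recursion.\<close>

locale well_ordered_resolution =
  fixes r :: "'b rel" and R :: "'b set \<Rightarrow> 'a::real_normed_vector \<Rightarrow> 'a"
  assumes wo: "Well_order r"
    and finitely_determined: "T \<subseteq> Field r \<Longrightarrow> 0 < e \<Longrightarrow>
      \<exists>F. finite F \<and> F \<subseteq> T \<and> (\<forall>T'. F \<subseteq> T' \<longrightarrow> T' \<subseteq> T \<longrightarrow> dist (R T' x) (R T x) \<le> e)"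
begin

definition step :: "'b \<Rightarrow> 'a \<Rightarrow> 'a" where
  "step a x = R (under r a) x - R (underS r a) x"

definition segment :: "'b set \<Rightarrow> bool" where
  "segment I \<longleftrightarrow> I \<subseteq> Field r \<and> (\<forall>a\<in>I. under r a \<subseteq> I)"

lemma order_r: "refl_on (Field r) r" "trans r" "antisym r" "total_on (Field r) r" "wf (r - Id)"
  using wo by (auto simp: order_on_defs well_order_on_def)

lemma r_total: "a \<in> Field r \<Longrightarrow> b \<in> Field r \<Longrightarrow> (a, b) \<in> r \<or> (b, a) \<in> r"
  using order_r(1,4) by (cases "a = b") (auto simp: refl_on_def total_on_def)

lemma under_mono: "(a, b) \<in> r \<Longrightarrow> under r a \<subseteq> under r b"
  using order_r(2) by (auto simp: under_def dest: transD)

lemma under_subset_underS: "(a, b) \<in> r \<Longrightarrow> a \<noteq> b \<Longrightarrow> under r a \<subseteq> underS r b"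
  using order_r(2,3) by (auto simp: under_def underS_def dest: transD antisymD)

lemma under_eq_insert: "a \<in> Field r \<Longrightarrow> under r a = insert a (underS r a)"
  using order_r(1) by (auto simp: under_def underS_def refl_on_def)

lemma segment_underS: "segment (underS r a)"
  using under_subset_underS by (auto simp: segment_def underS_def Field_def)

lemma segment_Field: "segment (Field r)"
  by (auto simp: segment_def under_def Field_def)

lemma segment_approx:
  assumes I: "segment I" "I \<noteq> {}" and e: "e > 0"
  obtains b where "b \<in> I" "\<And>T. under r b \<subseteq> T \<Longrightarrow> T \<subseteq> I \<Longrightarrow> dist (R T x) (R I x) \<le> e"
proof -
  obtain F where F: "finite F" "F \<subseteq> I"
    "\<And>T'. F \<subseteq> T' \<Longrightarrow> T' \<subseteq> I \<Longrightarrow> dist (R T' x) (R I x) \<le> e"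
    using finitely_determined[of I e x] I(1) e by (auto simp: segment_def)
  have "\<exists>b\<in>I. F \<subseteq> under r b"
    using F(1,2)
  proof (induction F)
    case empty
    then show ?case using I(2) by blast
  next
    case (insert a F)
    then obtain b where b: "b \<in> I" "F \<subseteq> under r b" by blast
    have "a \<in> Field r" "b \<in> Field r" using insert.prems b I(1) by (auto simp: segment_def)
    then have "(a, b) \<in> r \<or> (b, a) \<in> r" by (rule r_total)
    then show ?case
    proof
      assume "(a, b) \<in> r"
      then show ?thesis using b by (intro bexI[of _ b]) (auto simp: under_def)
    next
      assume "(b, a) \<in> r"
      then show ?thesis
        using b under_mono[of b a] insert.prems under_eq_insert[OF \<open>a \<in> Field r\<close>]
        by (intro bexI[of _ a]) auto
    qed
  qed
  then show ?thesis using F(3) that by (metis subset_trans)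
qed

text \<open>The value at a nonempty segment is a limit of the values at the closed initial segments in it, because a
  finite set is contained in one of these. This and the analogous lemma on large steps treat successor
  and limit positions alike.\<close>

lemma segment_mem_closed:
  assumes I: "segment I" and V: "closed V" "R {} x \<in> V" "\<And>b. b \<in> I \<Longrightarrow> R (under r b) x \<in> V"
  shows "R I x \<in> V"
proof (cases "I = {}")
  case False
  have "\<exists>y\<in>V. dist y (R I x) < e" if "e > 0" for e
  proof -
    obtain b where b: "b \<in> I" "\<And>T. under r b \<subseteq> T \<Longrightarrow> T \<subseteq> I \<Longrightarrow> dist (R T x) (R I x) \<le> e / 2"
      using segment_approx[OF I False, of "e / 2" x] \<open>e > 0\<close> by auto
    have "under r b \<subseteq> I" using I b(1) by (auto simp: segment_def)
    then have "dist (R (under r b) x) (R I x) \<le> e / 2" using b(2) by blast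
    also have "\<dots> < e" using that by simp
    finally show ?thesis using V(3)[OF b(1)] by blast
  qed
  then have "R I x \<in> closure V" by (auto simp: closure_approachable)
  then show ?thesis using V(1) by (simp add: closure_closed)
qed (use V in simp)

text \<open>Used with \<open>V = {0}\<close>, this says that a point without components in the resolution is zero; used with the
  closed span of a set, that the set generates the whole range.\<close>

lemma mem_closed_if_steps:
  assumes V: "closed V" "R {} x \<in> V" "\<And>y z. y \<in> V \<Longrightarrow> z \<in> V \<Longrightarrow> y + z \<in> V"
    and step: "\<And>a. a \<in> Field r \<Longrightarrow> step a x \<in> V"
  shows "R (Field r) x \<in> V"
proof -
  have "a \<in> Field r \<longrightarrow> R (under r a) x \<in> V" for a
    using order_r(5)
  proof (induction a rule: wf_induct_rule)
    case (less a)
    show ?case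
    proof
      assume a: "a \<in> Field r"
      have "R (under r b) x \<in> V" if "b \<in> underS r a" for b
        using less[of b] that by (auto simp: underS_def Field_def)
      then have "R (underS r a) x \<in> V"
        by (rule segment_mem_closed[OF segment_underS V(1,2)])
      then have "R (underS r a) x + step a x \<in> V"
        using V(3) step[OF a] by blast
      then show "R (under r a) x \<in> V" by (simp add: step_def)
    qed
  qed
  then show ?thesis by (intro segment_mem_closed[OF segment_Field V(1,2)]) blast
qed

text \<open>All values beyond some \<open>b\<close> in the segment are within \<open>e / 2\<close> of the value at the segment itself, so a
  step of size more than \<open>e\<close> occurs at \<open>b\<close> or below.\<close>

lemma finite_large_steps_segment:
  assumes I: "segment I" and e: "e > 0"
    and fin: "\<And>b. b \<in> I \<Longrightarrow> finite {c \<in> under r b. norm (step c x) > e}"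
  shows "finite {c \<in> I. norm (step c x) > e}"
proof (cases "I = {}")
  case False
  obtain b where b: "b \<in> I" "\<And>T. under r b \<subseteq> T \<Longrightarrow> T \<subseteq> I \<Longrightarrow> dist (R T x) (R I x) \<le> e / 2"
    using segment_approx[OF I False, of "e / 2" x] e by auto
  have "c \<in> under r b" if c: "c \<in> I" "norm (step c x) > e" for c
  proof (rule ccontr)
    assume "c \<notin> under r b"
    moreover have "b \<in> Field r" "c \<in> Field r"
      using b(1) c(1) I by (auto simp: segment_def)
    ultimately have "(b, c) \<in> r" "b \<noteq> c"
      using r_total[of b c] r_total[of b b] by (auto simp: under_def)
    then have "under r b \<subseteq> underS r c" by (rule under_subset_underS)
    moreover have "underS r c \<subseteq> under r c" "under r c \<subseteq> I"
      using I c(1) by (auto simp: segment_def underS_def under_def)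
    ultimately have "dist (R (under r c) x) (R I x) \<le> e / 2" "dist (R (underS r c) x) (R I x) \<le> e / 2"
      using b(2) by blast+
    then have "dist (R (under r c) x) (R (underS r c) x) \<le> e"
      using dist_triangle2[of "R (under r c) x" "R (underS r c) x" "R I x"] by linarith
    with c(2) show False by (simp add: step_def dist_norm)
  qed
  then have "{c \<in> I. norm (step c x) > e} \<subseteq> {c \<in> under r b. norm (step c x) > e}" by auto
  then show ?thesis using fin[OF b(1)] by (rule finite_subset)
qed simp

lemma finite_large_steps:
  assumes e: "e > 0"
  shows "finite {c \<in> Field r. norm (step c x) > e}"
proof -
  have "a \<in> Field r \<longrightarrow> finite {c \<in> under r a. norm (step c x) > e}" for a
    using order_r(5)
  proof (induction a rule: wf_induct_rule)
    case (less a)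
    show ?case
    proof
      assume a: "a \<in> Field r"
      have "finite {c \<in> under r b. norm (step c x) > e}" if "b \<in> underS r a" for b
        using less[of b] that by (auto simp: underS_def Field_def)
      then have "finite {c \<in> underS r a. norm (step c x) > e}"
        by (rule finite_large_steps_segment[OF segment_underS e])
      then have "finite (insert a {c \<in> underS r a. norm (step c x) > e})" by simp
      then show "finite {c \<in> under r a. norm (step c x) > e}"
        by (rule finite_subset[rotated]) (auto simp: under_eq_insert[OF a])
    qed
  qed
  then show ?thesis by (intro finite_large_steps_segment[OF segment_Field e]) blast
qed

lemma countable_nonzero_steps: "countable {c \<in> Field r. step c x \<noteq> 0}"
proof -
  have "\<exists>n. norm (step c x) > inverse (real (Suc n))" if "step c x \<noteq> 0" for c
    using that by (intro reals_Archimedean) simp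
  then have "{c \<in> Field r. step c x \<noteq> 0} \<subseteq> (\<Union>n. {c \<in> Field r. norm (step c x) > inverse (real (Suc n))})"
    by blast
  moreover have "countable (\<Union>n. {c \<in> Field r. norm (step c x) > inverse (real (Suc n))})"
    by (rule countable_UN[OF countableI_type], rule countable_finite, rule finite_large_steps) simp
  ultimately show ?thesis by (rule countable_subset)
qed

end

section \<open>Resolutions by limit projections\<close>

locale weakly_continuous_skeleton = bounded_skeleton smul P G K
  for smul :: "'k::real_or_complex \<Rightarrow> 'a::banach \<Rightarrow> 'a" and P :: "'i::order \<Rightarrow> 'a \<Rightarrow> 'a" and G K +
  assumes limit_D_operator:
    "A \<subseteq> G \<Longrightarrow> directed A \<Longrightarrow> A \<noteq> {} \<Longrightarrow> D_operator (limit_projection P A)"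

text \<open>The indices \<open>h F\<close> are taken among those whose projections commute with \<open>Q\<close>, so that \<open>P (h F) \<circ> Q\<close> and the
  limits formed from them are projections, too.\<close>

locale finitely_indexed_projections = weakly_continuous_skeleton smul P G K
  for smul :: "'k::real_or_complex \<Rightarrow> 'a::banach \<Rightarrow> 'a" and P :: "'i::order \<Rightarrow> 'a \<Rightarrow> 'a" and G K +
  fixes Q :: "'a \<Rightarrow> 'a" and h :: "'a set \<Rightarrow> 'i"
  assumes Q_D_operator: "D_operator Q"
    and Q_idem: "Q (Q x) = Q x"
    and h_mem: "finite F \<Longrightarrow> h F \<in> G"
    and h_commutes: "finite F \<Longrightarrow> P (h F) (Q x) = Q (P (h F) x)"
    and h_fixes: "finite F \<Longrightarrow> x \<in> F \<Longrightarrow> P (h F) x = x"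
    and h_mono: "finite F \<Longrightarrow> F' \<subseteq> F \<Longrightarrow> h F' \<le> h F"
begin

definition indices :: "'a set \<Rightarrow> 'i set" where
  "indices T = h ` {F. finite F \<and> F \<subseteq> T}"

definition R :: "'a set \<Rightarrow> 'a \<Rightarrow> 'a" where
  "R T x = limit_projection P (indices T) (Q x)"

lemma indices: "indices T \<subseteq> G" "directed (indices T)" "indices T \<noteq> {}"
proof -
  show "indices T \<subseteq> G" by (auto simp: indices_def h_mem)
  show "indices T \<noteq> {}" by (auto simp: indices_def)
  show "directed (indices T)"
    unfolding directed_def
  proof (intro ballI)
    fix s t assume "s \<in> indices T" "t \<in> indices T"
    then obtain F F' where F: "s = h F" "t = h F'" "finite F" "finite F'" "F \<subseteq> T" "F' \<subseteq> T"
      by (auto simp: indices_def)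
    then have "h (F \<union> F') \<in> indices T" by (auto simp: indices_def)
    moreover have "s \<le> h (F \<union> F')" "t \<le> h (F \<union> F')" using F h_mono[of "F \<union> F'"] by auto
    ultimately show "\<exists>u\<in>indices T. s \<le> u \<and> t \<le> u" by blast
  qed
qed

lemma indices_mono: "T \<subseteq> T' \<Longrightarrow> indices T \<subseteq> indices T'"
  by (auto simp: indices_def)

lemma Q_bounded_linear: "bounded_linear Q"
  using Q_D_operator by (rule D_operator_bounded_linear)

lemma limit_projection_indices_Q:
  "limit_projection P (indices T) (Q x) = Q (limit_projection P (indices T) x)"
  using h_commutes by (intro limit_projection_commute[OF indices Q_bounded_linear]) (auto simp: indices_def)

lemma R_eq: "R T x = Q (limit_projection P (indices T) x)"
  by (simp add: R_def limit_projection_indices_Q)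

lemma R_D_operator: "D_operator (R T)"
  unfolding R_def[abs_def] using limit_D_operator[OF indices] Q_D_operator by (rule D_operator_comp)

lemma R_diff: "R T (x - y) = R T x - R T y"
  using D_operator_bounded_linear[OF R_D_operator] by (simp add: bounded_linear.linear linear_diff)

lemma Q_R: "Q (R T x) = R T x"
  by (simp add: R_eq Q_idem)

lemma R_nested:
  assumes "T \<subseteq> T'"
  shows "R T (R T' x) = R T x" "R T' (R T x) = R T x"
  using limit_projection_nested[OF indices_mono[OF assms] indices(2,3) indices(1,2)]
  by (simp_all only: R_def[of _ "R _ _"] Q_R) (simp_all only: R_def)

lemma R_fixes:
  assumes "Q x \<in> closure T"
  shows "R T x = Q x"
proof -
  have "limit_projection P (indices T) y = y" if "y \<in> T" for y
  proof (rule limit_projection_fixed[OF indices])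
    show "h {y} \<in> indices T" using that by (auto simp: indices_def)
    show "P (h {y}) y = y" by (rule h_fixes) auto
  qed
  then have "T \<subseteq> {y. limit_projection P (indices T) y = y}" by blast
  moreover have "closed {y. limit_projection P (indices T) y = y}"
    by (rule closed_Collect_eq[OF linear_continuous_on[OF limit_projection_bounded_linear[OF indices]]
          continuous_on_id])
  ultimately have "closure T \<subseteq> {y. limit_projection P (indices T) y = y}" by (rule closure_minimal)
  then show ?thesis using assms by (auto simp: R_def)
qed

text \<open>If \<open>P t (Q x)\<close> is close to the limit \<open>R T x\<close> for all \<open>t \<ge> h F\<close> in the index set of \<open>T\<close>, then the same holds for
  the tail above \<open>h F\<close> in the smaller index set of \<open>T'\<close>, and so for its limit.\<close>

lemma R_finitely_determined:
  assumes e: "e > 0"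
  shows "\<exists>F. finite F \<and> F \<subseteq> T \<and> (\<forall>T'. F \<subseteq> T' \<longrightarrow> T' \<subseteq> T \<longrightarrow> dist (R T' x) (R T x) \<le> e)"
proof -
  have "eventually (\<lambda>s. dist (P s (Q x)) (R T x) < e) (tails (indices T))"
    using tendstoD[OF limit_projection_tendsto[OF indices] e] unfolding R_def .
  then obtain F where F: "finite F" "F \<subseteq> T"
    and close: "\<And>t. t \<in> indices T \<Longrightarrow> h F \<le> t \<Longrightarrow> dist (P t (Q x)) (R T x) < e"
    unfolding eventually_tails[OF indices(2,3)] by (auto simp: indices_def)
  have "dist (R T' x) (R T x) \<le> e" if T': "F \<subseteq> T'" "T' \<subseteq> T" for T'
  proof (rule tendsto_upperbound[OF _ _ tails_nontrivial[OF indices(2,3)]])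
    show "((\<lambda>t. dist (P t (Q x)) (R T x)) \<longlongrightarrow> dist (R T' x) (R T x)) (tails (indices T'))"
      unfolding R_def[of T'] by (intro tendsto_dist limit_projection_tendsto[OF indices] tendsto_const)
    have "h F \<in> indices T'" using F T' by (auto simp: indices_def)
    then have "eventually (\<lambda>t. t \<in> indices T' \<and> h F \<le> t) (tails (indices T'))"
      by (rule eventually_tails_ge[OF indices(2)])
    then show "eventually (\<lambda>t. dist (P t (Q x)) (R T x) \<le> e) (tails (indices T'))"
      by (rule eventually_mono) (use close indices_mono[OF T'(2)] in \<open>auto intro: less_imp_le\<close>)
  qed
  then show ?thesis using F by blast
qed

lemma range_R:
  assumes d: "\<And>s. range (P s) \<subseteq> closure (d s)"
  shows "range (R T) \<subseteq> closure (\<Union>F\<in>{F. finite F \<and> F \<subseteq> T}. d (h F))"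
proof -
  have "range (R T) \<subseteq> closure (\<Union>s\<in>indices T. range (P s))"
    using limit_projection_range[OF indices] by (auto simp: R_def)
  also have "\<dots> \<subseteq> closure (\<Union>s\<in>indices T. d s)"
  proof (rule closure_minimal[OF _ closed_closure])
    have "range (P s) \<subseteq> closure (\<Union>s\<in>indices T. d s)" if "s \<in> indices T" for s
      using d[of s] closure_mono[of "d s" "\<Union>s\<in>indices T. d s"] that by blast
    then show "(\<Union>s\<in>indices T. range (P s)) \<subseteq> closure (\<Union>s\<in>indices T. d s)" by blast
  qed
  also have "(\<Union>s\<in>indices T. d s) = (\<Union>F\<in>{F. finite F \<and> F \<subseteq> T}. d (h F))"
    by (auto simp: indices_def)
  finally show ?thesis .
qed

end

locale skeleton_resolution = finitely_indexed_projections smul P G K Q h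
  for smul :: "'k::real_or_complex \<Rightarrow> 'a::banach \<Rightarrow> 'a" and P :: "'i::order \<Rightarrow> 'a \<Rightarrow> 'a" and G K Q h +
  fixes r :: "'a rel"
  assumes well_order: "Well_order r"
    and dense: "range Q \<subseteq> closure (Field r)"

sublocale skeleton_resolution \<subseteq> well_ordered_resolution r R
  by unfold_locales (use well_order R_finitely_determined in auto)

context skeleton_resolution
begin

lemma R_Field: "R (Field r) x = Q x"
  using dense by (intro R_fixes) auto

lemma step_D_operator: "D_operator (step a)"
  unfolding step_def[abs_def] by (intro D_operator_diff R_D_operator)

lemma Q_step: "Q (step a x) = step a x"
  using Q_bounded_linear by (simp add: step_def bounded_linear.linear linear_diff Q_R)

lemma R_step:
  shows "under r a \<subseteq> T \<Longrightarrow> R T (step a x) = step a x"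
    and "T \<subseteq> underS r a \<Longrightarrow> R T (step a x) = 0"
  using R_nested[of "under r a" T] R_nested[of "underS r a" T] R_nested[of T "underS r a"]
    R_nested[of T "under r a"] underS_subset_under[of r a]
  by (auto simp: step_def R_diff)

lemma step_idem: "step a (step a x) = step a x"
  using R_step(1)[of a "under r a" x] R_step(2)[of "underS r a" a x]
  by (simp add: step_def[of a "step a x"])

lemma step_orthogonal:
  assumes "a \<in> Field r" "b \<in> Field r" "a \<noteq> b"
  shows "step a (step b x) = 0"
proof -
  consider "(a, b) \<in> r" | "(b, a) \<in> r" using r_total[OF assms(1,2)] by blast
  then show ?thesis
  proof cases
    case 1
    then have "under r a \<subseteq> underS r b" using assms(3) by (intro under_subset_underS)
    then show ?thesis
      using R_step(2)[of "under r a" b x] R_step(2)[of "underS r a" b x] underS_subset_under[of r a]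
      unfolding step_def[of a] by simp
  next
    case 2
    then have "under r b \<subseteq> underS r a" using assms(3) by (intro under_subset_underS) auto
    then show ?thesis
      using R_step(1)[of b "under r a" x] R_step(1)[of b "underS r a" x] underS_subset_under[of r a]
      unfolding step_def[of a] by simp
  qed
qed

text \<open>A functional \<open>f = f \<circ> P s\<close> cannot see a step vanishing on the separable range of \<open>P s\<close>, provided
  that \<open>P s\<close> commutes with \<open>Q\<close>, with \<open>R {}\<close> and with those steps that do not vanish there: for such a
  step \<open>c\<close> every part of \<open>P s (step c x)\<close> in the resolution is zero. No commutation with the
  uncountably many other steps is needed.\<close>

lemma countable_active_steps:
  assumes f: "f \<in> D"
  shows "countable {a \<in> Field r. \<exists>x. f (step a x) \<noteq> 0}"
proof -
  define act where "act s = {a \<in> Field r. \<exists>x. step a (P s x) \<noteq> 0}" for s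
  have act_countable: "countable (act s)" for s
  proof -
    obtain d where d: "countable d" "d \<subseteq> range (P s)" "range (P s) \<subseteq> closure d"
      by (rule countable_dense_in_range)
    have "act s \<subseteq> (\<Union>z\<in>d. {a \<in> Field r. step a z \<noteq> 0})"
    proof
      fix a assume a: "a \<in> act s"
      have "\<exists>z\<in>d. step a z \<noteq> 0"
      proof (rule ccontr)
        assume "\<not> (\<exists>z\<in>d. step a z \<noteq> 0)"
        then have "d \<subseteq> {z. step a z = 0}" by blast
        moreover have "closed {z. step a z = 0}"
          by (rule closed_Collect_eq[OF linear_continuous_on[OF D_operator_bounded_linear[OF step_D_operator]]
                continuous_on_const])
        ultimately have "closure d \<subseteq> {z. step a z = 0}" by (rule closure_minimal)
        then show False using a d(3) by (auto simp: act_def)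
      qed
      then show "a \<in> (\<Union>z\<in>d. {a \<in> Field r. step a z \<noteq> 0})" using a by (auto simp: act_def)
    qed
    moreover have "countable (\<Union>z\<in>d. {a \<in> Field r. step a z \<noteq> 0})"
      using d(1) countable_nonzero_steps by (rule countable_UN)
    ultimately show ?thesis by (rule countable_subset)
  qed
  obtain s0 where s0: "\<And>x. f (P s0 x) = f x" using f unfolding mem_D_iff by blast
  obtain s1 where s1: "s1 \<in> G" "s0 \<le> s1" by (rule G_above)
  define N where "N s = insert Q (insert (R {}) (step ` act s))" for s
  have N: "\<forall>s. countable (N s)" "\<forall>s. \<forall>S\<in>N s. D_operator S"
    using act_countable Q_D_operator R_D_operator step_D_operator by (auto simp: N_def)
  have "act s \<subseteq> act t" if "s \<le> t" for s t
    unfolding act_def using P_below(2)[OF that] by auto metis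
  then have N_mono: "\<forall>s t. s \<le> t \<longrightarrow> N s \<subseteq> N t"
    unfolding N_def by blast
  obtain \<sigma> :: "nat \<Rightarrow> 'i" and s where s: "s \<in> G" "s1 \<le> s" and lim: "\<And>x. (\<lambda>n. P (\<sigma> n) x) \<longlonglongrightarrow> P s x"
    and comm: "\<And>n S x. S \<in> N (\<sigma> n) \<Longrightarrow> P s (S x) = S (P s x)"
    by (rule commuting_index_above[OF s1(1) N N_mono]) (rule that)
  have fs: "f (P s x) = f x" for x
    using s0 s(2) s1(2) mem_D_above[of f s0 s] by (meson order_trans)
  have active: "step a (P s x) = 0" if "a \<in> Field r" "a \<notin> (\<Union>n. act (\<sigma> n))" for a x
  proof -
    have "step a (P (\<sigma> n) x) = 0" for n using that by (auto simp: act_def)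
    then have "(\<lambda>n. 0) \<longlonglongrightarrow> step a (P s x)"
      using bounded_linear.tendsto[OF D_operator_bounded_linear[OF step_D_operator] lim[of x], of a] by simp
    then show ?thesis by (simp add: LIMSEQ_const_iff)
  qed
  have "f (step c x) = 0" if c: "c \<in> Field r" "c \<notin> (\<Union>n. act (\<sigma> n))" for c x
  proof -
    define y where "y = P s (step c x)"
    have "R {} y = P s (R {} (step c x))"
      unfolding y_def by (rule comm[symmetric, of _ 0]) (simp add: N_def)
    also have "\<dots> = 0" using P_diff[of s 0 0] by (simp add: R_step(2))
    finally have "R {} y \<in> {0}" by simp
    moreover have "step a y \<in> {0}" if a: "a \<in> Field r" for a
    proof (cases "a \<in> (\<Union>n. act (\<sigma> n))")
      case True
      then obtain n where "step a \<in> N (\<sigma> n)" by (auto simp: N_def)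
      then have "step a y = P s (step a (step c x))" unfolding y_def by (rule comm[symmetric])
      also have "a \<noteq> c" using True c(2) by blast
      then have "P s (step a (step c x)) = 0"
        using step_orthogonal[OF a c(1)] P_diff[of s 0 0] by simp
      finally show ?thesis by simp
    qed (use active a in \<open>simp add: y_def\<close>)
    ultimately have "R (Field r) y \<in> {0}"
      by (intro mem_closed_if_steps) auto
    moreover have "Q y = y"
      using comm[of Q 0 "step c x"] by (simp add: N_def y_def Q_step)
    ultimately have "y = 0" by (simp add: R_Field)
    moreover have "f 0 = 0"
      using dual_space_bounded_linear[OF D_subset_dual[OF f]] by (simp add: bounded_linear.linear linear_0)
    ultimately show ?thesis using fs[of "step c x"] by (simp add: y_def)
  qed
  then have "{a \<in> Field r. \<exists>x. f (step a x) \<noteq> 0} \<subseteq> (\<Union>n. act (\<sigma> n))" by blast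
  then show ?thesis
    by (rule countable_subset) (intro countable_UN countableI_type act_countable)
qed

end

section \<open>Existence of a countably supporting set\<close>

context weakly_continuous_skeleton
begin

text \<open>By recursion on the cardinality: \<open>H n F\<close> is chosen above \<open>H (n - 1) F'\<close> for all \<open>F' \<subseteq> F\<close>. Including \<open>F' = F\<close> makes
  \<open>H n F\<close> increasing in \<open>n\<close>, which gives monotonicity for subsets of any smaller cardinality.\<close>

lemma finite_indexing_exists:
  assumes C: "C \<subseteq> G" "cofinal_subset C"
  obtains h :: "'a set \<Rightarrow> 'i" where "\<And>F. finite F \<Longrightarrow> h F \<in> C"
    "\<And>F x. finite F \<Longrightarrow> x \<in> F \<Longrightarrow> P (h F) x = x"
    "\<And>F F'. finite F \<Longrightarrow> F' \<subseteq> F \<Longrightarrow> h F' \<le> h F"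
proof -
  have "\<exists>t\<in>C. (\<forall>b\<in>B. b \<le> t) \<and> (\<forall>x\<in>F. P t x = x)" if fin: "finite B" "finite F" for B and F :: "'a set"
  proof -
    obtain s where s: "\<And>b. b \<in> B \<Longrightarrow> b \<le> s" "\<And>x. x \<in> closure F \<Longrightarrow> P s x = x"
      by (rule separable_set_in_range_P[OF countable_finite[OF fin(2)] countable_finite[OF fin(1)]]) blast
    obtain t where t: "t \<in> C" "s \<le> t" using C(2) by (auto simp: cofinal_subset_def)
    have "P t x = x" if "x \<in> F" for x
      using s(2)[OF subsetD[OF closure_subset that]] by (rule P_fixed_above[OF t(2)])
    moreover have "b \<le> t" if "b \<in> B" for b using s(1)[OF that] t(2) by (rule order_trans)
    ultimately show ?thesis using t(1) by blast
  qed
  then have ex: "\<exists>t. t \<in> C \<and> (\<forall>b\<in>B. b \<le> t) \<and> (\<forall>x\<in>F. P t x = x)"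
    if "finite B" "finite F" for B and F :: "'a set"
    using that by blast
  define g where "g B F = (SOME t. t \<in> C \<and> (\<forall>b\<in>B. b \<le> t) \<and> (\<forall>x\<in>F. P t x = x))" for B F
  have g: "g B F \<in> C" "b \<in> B \<Longrightarrow> b \<le> g B F" "x \<in> F \<Longrightarrow> P (g B F) x = x"
    if "finite B" "finite F" for B F b x
    using someI_ex[OF ex[OF that]] unfolding g_def by blast+
  define H where "H = rec_nat (g {}) (\<lambda>n H F. g (H ` Pow F) F)"
  have H: "H 0 F = g {} F" "H (Suc n) F = g (H n ` Pow F) F" for n F
    by (simp_all add: H_def)
  have H_step: "H n F' \<le> H (Suc n) F" if "finite F" "F' \<subseteq> F" for n F F'
    unfolding H(2) using that by (intro g(2)) auto
  have "H (card F') F' \<le> H (card F) F" if F: "finite F" "F' \<subseteq> F" for F F'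
  proof (cases "F' = F")
    case False
    then have "card F' < card F" using F psubset_card_mono by blast
    then obtain n where n: "card F = Suc n" "card F' \<le> n" by (cases "card F") auto
    have "mono (\<lambda>k. H k F')"
      using H_step[OF finite_subset[OF F(2,1)] order_refl] by (simp add: mono_iff_le_Suc)
    then have "H (card F') F' \<le> H n F'" using n(2) by (rule monoD)
    also have "\<dots> \<le> H (Suc n) F" using F by (rule H_step)
    finally show ?thesis by (simp add: n(1))
  qed simp
  moreover have "H n F \<in> C" "x \<in> F \<Longrightarrow> P (H n F) x = x" if "finite F" for n F x
    using g(1,3)[of _ F] that by (cases n; simp add: H)+
  ultimately show ?thesis by (intro that[of "\<lambda>F. H (card F) F"]) auto
qed

text \<open>Induction on the cardinality of \<open>S\<close>. A countable \<open>S\<close> has a countable image \<open>Q ` S\<close>, which serves as \<open>M\<close>. An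
  uncountable \<open>S\<close> is well-ordered by its cardinal, so that every proper initial segment is smaller than
  \<open>S\<close>, and \<open>M\<close> is the union of the sets obtained for \<open>R {}\<close> and for the steps of the resolution.\<close>

lemma countably_supporting_set_exists:
  "\<forall>Q. D_operator Q \<longrightarrow> (\<forall>x. Q (Q x) = Q x) \<longrightarrow> range Q \<subseteq> closure S \<longrightarrow>
    (\<exists>M\<subseteq>range Q. range Q \<subseteq> closure (local.span M) \<and> (\<forall>f\<in>D. countable {x\<in>M. f x \<noteq> 0}))"
proof (induction S rule: wf_induct_rule[OF wf_inv_image[OF wf_ordLess, where f = card_of]])
  case (1 S)
  have smaller: "\<exists>M\<subseteq>range Q. range Q \<subseteq> closure (local.span M) \<and> (\<forall>f\<in>D. countable {x\<in>M. f x \<noteq> 0})"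
    if "|T| <o |S|" "D_operator Q" "\<forall>x. Q (Q x) = Q x" "range Q \<subseteq> closure T" for T and Q
    using 1[of T] that by (simp add: inv_image_def)
  show ?case
  proof (intro allI impI)
    fix Q assume Q: "D_operator Q" "\<forall>x. Q (Q x) = Q x" "range Q \<subseteq> closure S"
    show "\<exists>M\<subseteq>range Q. range Q \<subseteq> closure (local.span M) \<and> (\<forall>f\<in>D. countable {x\<in>M. f x \<noteq> 0})"
    proof (cases "countable S")
      case True
      have "range Q = Q ` range Q" using Q(2) by (simp add: image_image)
      also have "\<dots> \<subseteq> Q ` closure S" using Q(3) by (rule image_mono)
      also have "\<dots> \<subseteq> closure (Q ` S)"
        by (rule closure_bounded_linear_image_subset[OF D_operator_bounded_linear[OF Q(1)]])
      also have "\<dots> \<subseteq> closure (local.span (Q ` S))" by (rule closure_mono[OF span_superset])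
      finally show ?thesis using True by (intro exI[of _ "Q ` S"]) (auto intro: countable_subset)
    next
      case False
      let ?C = "{s \<in> G. \<forall>x. P s (Q x) = Q (P s x)}"
      have "cofinal_subset ?C"
        unfolding cofinal_subset_def
      proof
        fix s
        obtain s0 where s0: "s0 \<in> G" "s \<le> s0" by (rule G_above)
        obtain t where "t \<in> G" "s0 \<le> t" "\<And>x. P t (Q x) = Q (P t x)"
          by (rule commuting_index_above[OF s0(1), of "\<lambda>_. {Q}"]) (use Q(1) in auto)
        then show "\<exists>t\<in>?C. s \<le> t" using s0(2) order_trans by blast
      qed
      then obtain h :: "'a set \<Rightarrow> 'i" where h: "\<And>F. finite F \<Longrightarrow> h F \<in> ?C"
        "\<And>F x. finite F \<Longrightarrow> x \<in> F \<Longrightarrow> P (h F) x = x"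
        "\<And>F F'. finite F \<Longrightarrow> F' \<subseteq> F \<Longrightarrow> h F' \<le> h F"
        by (rule finite_indexing_exists[rotated]) (rule that, auto)
      interpret skeleton_resolution smul P G K Q h "|S|"
        using Q h by unfold_locales (auto simp: Field_card_of card_of_well_order_on)
      have "\<exists>d. countable d \<and> range (P s) \<subseteq> closure d" for s
        by (rule countable_dense_in_range) blast
      then obtain d where d: "\<And>s. countable (d s)" "\<And>s. range (P s) \<subseteq> closure (d s)" by metis
      let ?d = "\<lambda>T. \<Union>F\<in>{F. finite F \<and> F \<subseteq> T}. d (h F)"
      have "\<exists>M\<subseteq>range (step a). range (step a) \<subseteq> closure (local.span M) \<and>
          (\<forall>f\<in>D. countable {x\<in>M. f x \<noteq> 0})" if a: "a \<in> S" for a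
      proof -
        have "|?d (insert a (underS |S| a))| <o |S|"
          using False d(1) a
          by (intro card_of_finitely_indexed_union card_of_underS) (auto simp: card_of_card_order_on Field_card_of)
        then have "|?d (under |S| a)| <o |S|" using a by (simp add: under_eq_insert Field_card_of)
        moreover have "range (step a) \<subseteq> range (R (under |S| a))"
          using R_step(1)[of a "under |S| a"] by (metis image_subsetI order_refl rangeI)
        then have "range (step a) \<subseteq> closure (?d (under |S| a))"
          using range_R[OF d(2)] by (rule subset_trans)
        ultimately show ?thesis
          by (intro smaller[OF _ step_D_operator]) (auto simp: step_idem)
      qed
      then have "\<forall>a\<in>S. \<exists>M. M \<subseteq> range (step a) \<and> range (step a) \<subseteq> closure (local.span M) \<and>
          (\<forall>f\<in>D. countable {x\<in>M. f x \<noteq> 0})"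
        by blast
      from bchoice[OF this] obtain M where M_all: "\<forall>a\<in>S. M a \<subseteq> range (step a) \<and>
          range (step a) \<subseteq> closure (local.span (M a)) \<and> (\<forall>f\<in>D. countable {x\<in>M a. f x \<noteq> 0})"
        by blast
      have M: "M a \<subseteq> range (step a)" "range (step a) \<subseteq> closure (local.span (M a))"
        "f \<in> D \<Longrightarrow> countable {x\<in>M a. f x \<noteq> 0}" if "a \<in> S" for a f
        using M_all that by simp_all
      have "|?d {}| <o |S|"
      proof (rule countable_ordLess_uncountable[OF _ False])
        have "?d {} = d (h {})" by auto
        then show "countable (?d {})" using d(1) by simp
      qed
      then have "\<exists>M\<subseteq>range (R {}). range (R {}) \<subseteq> closure (local.span M) \<and>
          (\<forall>f\<in>D. countable {x\<in>M. f x \<noteq> 0})"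
        by (rule smaller[OF _ R_D_operator _ range_R[OF d(2)]]) (simp add: R_nested)
      then obtain M0 where "M0 \<subseteq> range (R {}) \<and> range (R {}) \<subseteq> closure (local.span M0) \<and>
          (\<forall>f\<in>D. countable {x\<in>M0. f x \<noteq> 0})"
        by (rule exE)
      then have M0: "M0 \<subseteq> range (R {})" "range (R {}) \<subseteq> closure (local.span M0)"
        "f \<in> D \<Longrightarrow> countable {x\<in>M0. f x \<noteq> 0}" for f
        by simp_all
      define M' where "M' = M0 \<union> (\<Union>a\<in>S. M a)"
      have "R {} x \<in> range Q" "step a x \<in> range Q" for a x
        using Q_R[of "{}" x] Q_step[of a x] by (metis rangeI)+
      then have "M' \<subseteq> range Q" using M(1) M0(1) unfolding M'_def by blast
      moreover have "range Q \<subseteq> closure (local.span M')"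
      proof clarify
        fix x
        have "local.span M0 \<subseteq> local.span M'" "\<And>a. a \<in> S \<Longrightarrow> local.span (M a) \<subseteq> local.span M'"
          unfolding M'_def by (intro span_mono; blast)+
        then have "closure (local.span M0) \<subseteq> closure (local.span M')"
          "\<And>a. a \<in> S \<Longrightarrow> closure (local.span (M a)) \<subseteq> closure (local.span M')"
          by (auto intro!: closure_mono)
        then have R0: "R {} x \<in> closure (local.span M')"
          and steps: "\<And>a. a \<in> S \<Longrightarrow> step a x \<in> closure (local.span M')"
          using M0(2) M(2) by blast+
        have "R (Field |S| ) x \<in> closure (local.span M')"
        proof (rule mem_closed_if_steps[OF closed_closure R0])
          fix y z assume "y \<in> closure (local.span M')" "z \<in> closure (local.span M')"
          then obtain u v where "\<And>n. u n \<in> local.span M'" "u \<longlonglongrightarrow> y" "\<And>n. v n \<in> local.span M'" "v \<longlonglongrightarrow> z"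
            unfolding closure_sequential by blast
          then show "y + z \<in> closure (local.span M')"
            unfolding closure_sequential by (intro exI[of _ "\<lambda>n. u n + v n"]) (simp add: span_add tendsto_add)
        qed (simp add: steps Field_card_of)
        then show "Q x \<in> closure (local.span M')" by (simp add: R_Field)
      qed
      moreover have "countable {x\<in>M'. f x \<noteq> 0}" if f: "f \<in> D" for f
      proof -
        let ?E = "{a \<in> S. \<exists>x. f (step a x) \<noteq> 0}"
        have "{x\<in>M'. f x \<noteq> 0} \<subseteq> {x\<in>M0. f x \<noteq> 0} \<union> (\<Union>a\<in>?E. {x\<in>M a. f x \<noteq> 0})"
          unfolding M'_def using M(1) by blast
        moreover have "countable ?E"
          using countable_active_steps[OF f] by (simp add: Field_card_of)
        then have "countable ({x\<in>M0. f x \<noteq> 0} \<union> (\<Union>a\<in>?E. {x\<in>M a. f x \<noteq> 0}))"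
          using M0(3)[OF f] M(3)[OF _ f] by (intro countable_Un countable_UN) auto
        ultimately show ?thesis by (rule countable_subset)
      qed
      ultimately show ?thesis by blast
    qed
  qed
qed

lemma Sigma_subspace_D: "Sigma_subspace smul D"
proof -
  obtain M where "UNIV \<subseteq> closure (local.span M)" "\<And>f. f \<in> D \<Longrightarrow> countable {x\<in>M. f x \<noteq> 0}"
    using countably_supporting_set_exists[of UNIV] D_operator_id by auto
  then show ?thesis by (intro Sigma_subspaceI[of M]) auto
qed

end

section \<open>The equivalences\<close>

context projectional_skeleton
begin

lemma commuting_if_Sigma_subspace:
  assumes "Sigma_subspace smul D"
  shows "\<exists>G. sigma_closed G \<and> cofinal_subset G \<and> (\<forall>s\<in>G. \<forall>t\<in>G. P s \<circ> P t = P t \<circ> P s)"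
proof -
  obtain M where M: "closure (local.span M) = UNIV"
    "D = {f \<in> dual_space smul. countable {x\<in>M. f x \<noteq> 0}}"
    using assms by (auto simp: Sigma_subspace_def)
  obtain G K where "bounded_skeleton smul P G K"
    by (rule bounded_skeleton_exists[of UNIV]) (auto simp: sigma_closed_def cofinal_subset_def)
  then interpret bounded_skeleton smul P G K .
  have "countable {x\<in>M. f x \<noteq> 0}" if "f \<in> D" for f using M(2) that by blast
  from sigma_closed_splitting cofinal_splitting[OF this] splitting_projections_commute[OF M(1)]
  show ?thesis by (intro exI[of _ "splitting_indices M"]) (auto simp: fun_eq_iff)
qed

text \<open>The set is shrunk to a uniformly bounded one, where all the limit projections exist; the smaller
  set is again \<open>\<sigma>\<close>-closed and cofinal, and its projections still commute.\<close>

lemma continuous_if_commuting: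
  assumes G: "sigma_closed G" "cofinal_subset G" "\<forall>s\<in>G. \<forall>t\<in>G. P s \<circ> P t = P t \<circ> P s"
  shows "\<exists>G. sigma_closed G \<and> cofinal_subset G \<and> (\<forall>A. A \<subseteq> G \<and> directed A \<longrightarrow>
    well_defined_limit_projection smul P A \<and>
    continuous_map (weak_topology D) (weak_topology D) (limit_projection P A))"
proof -
  obtain G' K where G': "G' \<subseteq> G" "bounded_skeleton smul P G' K"
    using bounded_skeleton_exists[OF G(1,2)] by blast
  interpret bounded_skeleton smul P G' K by (rule G'(2))
  have comm: "P s (P t x) = P t (P s x)" if "s \<in> G'" "t \<in> G'" for s t x
    using G(3) that G'(1) by (metis comp_apply subsetD)
  have zero: "D_operator (\<lambda>x. 0)"
    using D_operator_diff[OF D_operator_id D_operator_id] by simp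
  have "well_defined_limit_projection smul P A \<and> D_operator (limit_projection P A)"
    if A: "A \<subseteq> G'" "directed A" for A
  proof (cases "A = {}")
    case True
    then have "limit_projection P A = (\<lambda>x. 0)" by (simp add: limit_projection_def fun_eq_iff)
    then show ?thesis
      using True zero by (simp add: well_defined_limit_projection_def bounded_projection_def comp_def
          Vector_Spaces.linear_iff vector_space_smul D_operator_bounded_linear)
  next
    case False
    have "bounded_projection smul (limit_projection P A)"
      using limit_projection_bounded_linear[OF A False] limit_projection_smul[OF A False]
        limit_projection_idem[OF A False]
      by (simp add: bounded_projection_def Vector_Spaces.linear_iff vector_space_smul fun_eq_iff
          bounded_linear.linear linear_add)
    then show ?thesis
      using limit_exists[OF A False] commuting_limit_projection_D_operator[OF comm A False]
      by (simp add: well_defined_limit_projection_def)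
  qed
  then have "\<forall>A. A \<subseteq> G' \<and> directed A \<longrightarrow> well_defined_limit_projection smul P A \<and>
    continuous_map (weak_topology D) (weak_topology D) (limit_projection P A)"
    using continuous_if_D_operator by blast
  then show ?thesis using sigma_closed_G cofinal_G by blast
qed

lemma Sigma_subspace_if_continuous:
  assumes G: "sigma_closed G" "cofinal_subset G"
    and cont: "\<forall>A. A \<subseteq> G \<and> directed A \<longrightarrow> well_defined_limit_projection smul P A \<and>
      continuous_map (weak_topology D) (weak_topology D) (limit_projection P A)"
  shows "Sigma_subspace smul D"
proof -
  obtain G' K where G': "G' \<subseteq> G" "bounded_skeleton smul P G' K"
    using bounded_skeleton_exists[OF G] by blast
  interpret bounded_skeleton smul P G' K by (rule G'(2))
  have "D_operator (limit_projection P A)" if A: "A \<subseteq> G'" "directed A" "A \<noteq> {}" for A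
    using cont A G'(1) limit_projection_bounded_linear[OF A] limit_projection_smul[OF A]
    by (intro D_operator_if_continuous) auto
  then interpret weakly_continuous_skeleton smul P G' K by unfold_locales
  show ?thesis by (rule Sigma_subspace_D)
qed

end

unbundle no cardinal_syntax

theorem theorem3p4:
  fixes smul :: "'k::real_or_complex \<Rightarrow> 'a::banach \<Rightarrow> 'a"
    and P :: "'i::order \<Rightarrow> 'a \<Rightarrow> 'a"
    and D :: "('a \<Rightarrow> 'k) set"
  assumes "projectional_skeleton smul P"
    and "D = induced_subspace smul P"
  shows
    "(Sigma_subspace smul D
      \<longleftrightarrow>
      (\<exists>G. sigma_closed G \<and> cofinal_subset G \<and> (\<forall>s\<in>G. \<forall>t\<in>G. P s \<circ> P t = P t \<circ> P s)))
     \<and>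
     ((\<exists>G. sigma_closed G \<and> cofinal_subset G \<and> (\<forall>s\<in>G. \<forall>t\<in>G. P s \<circ> P t = P t \<circ> P s))
      \<longleftrightarrow>
      (\<exists>G. sigma_closed G \<and> cofinal_subset G \<and>
        (\<forall>A. A \<subseteq> G \<and> directed A \<longrightarrow>
           well_defined_limit_projection smul P A \<and>
           continuous_map (weak_topology D) (weak_topology D) (limit_projection P A))))"
proof -
  interpret projectional_skeleton smul P by fact
  show ?thesis
    unfolding assms(2)
    using commuting_if_Sigma_subspace continuous_if_commuting Sigma_subspace_if_continuous by blast
qed

end
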